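(* Let $n\in\mathbb N$ and $a_i>0$, $b_i>0$ for $1\le i\le n$. Let $\{\xi^{(n)}_k\}_{k\ge0}$ be the exact coefficients in the Chebyshev expansion $$\beta\Big(\begin{matrix} a_1,\dots,a_n\\ b_1,\dots,b_n\end{matrix}\Big\vert z\Big)=\frac12\xi^{(n)}_0+\sum_{k\ge1}\xi^{(n)}_kT_k(4z-1),\qquad 0\le z\le 1/2,$$ and, for each integer $N\ge1$, let $\{\hat\xi^{(n)}_k\}_{0\le k\le N}$ (which depend on $N$) be the approximate coefficients produced by the Chebyshev algorithm with truncation parameter $N$ described in the context. Then there exists a constant $C$ (depending on the $a_i$ and $b_i$) such that for all $N\ge1$ $$\max_{0\le k\le N}\big|\hat\xi^{(n)}_k-\xi^{(n)}_k\big|<C\,3^{-8N/5}.$$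
   Context: For $n\in\mathbb N$, $a_i>0$, $b_i>0$ ($1\le i\le n$) and $z\in[0,1]$, the generalized incomplete beta function is $$\mathrm B\Big(\begin{matrix} a_1,\dots,a_n\\ b_1,\dots,b_n\end{matrix}\Big\vert z\Big)=\int\mathbf 1_{\{0\le x_1\le x_2\le\dots\le x_n\le z\}}\prod_{i=1}^nx_i^{a_i-1}(1-x_i)^{b_i-1}\,\mathrm dx_1\cdots\mathrm dx_n ,$$ and for $z\in(0,1]$ $$\beta\Big(\begin{matrix} a_1,\dots,a_n\\ b_1,\dots,b_n\end{matrix}\Big\vert z\Big):=z^{-a_1-a_2-\dots-a_n}\,\mathrm B\Big(\begin{matrix} a_1,\dots,a_n\\ b_1,\dots,b_n\end{matrix}\Big\vert z\Big).$$ The function $z\mapsto\beta\Big(\begin{matrix} a_1,\dots,a_n\\ b_1,\dots,b_n\end{matrix}\Big\vert z\Big)$ extends from $(0,1)$ to an analytic function in $\mathbb C\setminus[1,\infty)$, denoted by the same symbol (so its value at $z=0$ is defined). $T_k$ is the Chebyshev polynomial of the first kind, $T_k(\cos\theta)=\cos(k\theta)$. Explicitly, the Chebyshev coefficients of a function $g$ on $[0,1/2]$ in the normalization $g(z)=\frac12w_0+\sum_{k\ge1}w_kT_k(4z-1)$ are $w_k=\frac2\pi\int_0^\pi g\big((1+\cos\theta)/4\big)\cos(k\theta)\,\mathrm d\theta$. The Chebyshev algorithm (all arithmetic exact). Fix an integer $N\ge1$ and set $x_j:=\cos\big(\frac{\pi(j+1/2)}{N+1}\big)$ for $0\le j\le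 N$, and $A_m:=a_1+a_2+\dots+a_m$. Initialize $\hat\xi^{(0)}_0=2$ and $\hat\xi^{(0)}_k=0$ for $1\le k\le N$. Then for $m=1,2,\dots,n$ successively perform the following steps (the quantities $v_j,\eta_k,\mu_k$ are recomputed for each $m$). Step 1. For $j=0,1,\dots,N$, $$v_j=\frac12\hat\xi^{(m-1)}_0+\sum_{k=1}^N\hat\xi^{(m-1)}_k\cos\Big(\frac{\pi k(j+1/2)}{N+1}\Big).$$ Step 2. For $k=0,1,\dots,N$, $$\eta_k=\frac{2}{N+1}\sum_{j=0}^N\big(1-(1+x_j)/4\big)^{b_m-1}v_j\cos\Big(\frac{\pi k(j+1/2)}{N+1}\Big).$$ Step 3. Set $\mu_N=\mu_{N+1}=0$ and compute recursively, for $k=N,N-1,\dots,1$, $$\mu_{k-1}=\frac{1}{1+A_m/k}\Big(8\eta_k-2\mu_k-\mu_{k+1}(1-A_m/k)\Big).$$ Step 4. Set $$\hat\xi^{(m)}_0=\frac1{A_m}\Big(\eta_0-\frac14(\mu_0+\mu_1)\Big),\qquad \hat\xi^{(m)}_k=\frac{\mu_{k-1}-\mu_{k+1}}{8k},\quad k=1,2,\dots,N.$$ The output after $m=n$ is $\{\hat\xi^{(n)}_k\}_{0\le k\le N}$. *)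

theory Defs
  imports "HOL-Analysis.Analysis"
begin

text \<open>Parameter sequences \<open>a\<close>, \<open>b\<close> are functions on \<open>nat\<close> of which only the values at the
  indices \<open>1, \<dots>, n\<close> matter.\<close>

definition inc_beta :: "nat \<Rightarrow> (nat \<Rightarrow> real) \<Rightarrow> (nat \<Rightarrow> real) \<Rightarrow> real \<Rightarrow> real" where
  "inc_beta n a b z =
     (LINT x | (\<Pi>\<^sub>M i\<in>{1..n}. lborel).
        indicator {x. (\<forall>i\<in>{1..n}. 0 \<le> x i \<and> x i \<le> z) \<and>
                      (\<forall>i\<in>{1..n}. \<forall>j\<in>{1..n}. i \<le> j \<longrightarrow> x i \<le> x j)} x *
        (\<Prod>i\<in>{1..n}. x i powr (a i - 1) * (1 - x i) powr (b i - 1)))"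

definition norm_beta :: "nat \<Rightarrow> (nat \<Rightarrow> real) \<Rightarrow> (nat \<Rightarrow> real) \<Rightarrow> real \<Rightarrow> real" where
  "norm_beta n a b z = z powr (- (\<Sum>i=1..n. a i)) * inc_beta n a b z"

text \<open>By the identity theorem, the values on the slit plane do not depend on the choice made
  by \<open>SOME\<close>; the values on the cut are unspecified.\<close>

definition beta_ext :: "nat \<Rightarrow> (nat \<Rightarrow> real) \<Rightarrow> (nat \<Rightarrow> real) \<Rightarrow> complex \<Rightarrow> complex" where
  "beta_ext n a b =
     (SOME f. f analytic_on - (complex_of_real ` {1..}) \<and>
              (\<forall>z\<in>{0<..<1}. f (complex_of_real z) = complex_of_real (norm_beta n a b z)))"

text \<open>Coefficients of \<open>g(z) = w\<^sub>0/2 + (\<Sum>k\<ge>1. w\<^sub>k T\<^sub>k(4z - 1))\<close> on \<open>[0, 1/2]\<close>, where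
  \<open>z = (1 + cos \<theta>)/4\<close> and \<open>T\<^sub>k(cos \<theta>) = cos (k\<theta>)\<close>.\<close>

definition cheb_coeff :: "(real \<Rightarrow> real) \<Rightarrow> nat \<Rightarrow> real" where
  "cheb_coeff g k = 2 / pi * integral {0..pi} (\<lambda>\<theta>. g ((1 + cos \<theta>) / 4) * cos (real k * \<theta>))"

text \<open>The extension is real on \<open>[0, 1/2]\<close>, so taking the real part loses nothing.\<close>

definition exact_coeff :: "nat \<Rightarrow> (nat \<Rightarrow> real) \<Rightarrow> (nat \<Rightarrow> real) \<Rightarrow> nat \<Rightarrow> real" where
  "exact_coeff n a b k = cheb_coeff (\<lambda>z. Re (beta_ext n a b (complex_of_real z))) k"

definition cheb_angle :: "nat \<Rightarrow> nat \<Rightarrow> real" where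
  "cheb_angle N j = pi * (real j + 1/2) / (real N + 1)"

definition cheb_node :: "nat \<Rightarrow> nat \<Rightarrow> real" where
  "cheb_node N j = cos (cheb_angle N j)"

definition node_value :: "nat \<Rightarrow> (nat \<Rightarrow> real) \<Rightarrow> nat \<Rightarrow> real" where
  "node_value N \<xi> j = \<xi> 0 / 2 + (\<Sum>k=1..N. \<xi> k * cos (real k * cheb_angle N j))"

definition product_coeff :: "nat \<Rightarrow> real \<Rightarrow> (nat \<Rightarrow> real) \<Rightarrow> nat \<Rightarrow> real" where
  "product_coeff N \<beta> v k =
     2 / (real N + 1) *
       (\<Sum>j=0..N. (1 - (1 + cheb_node N j) / 4) powr (\<beta> - 1) * v j * cos (real k * cheb_angle N j))"

text \<open>The recursion runs downwards from \<open>\<mu>\<^sub>N = \<mu>\<^sub>N\<^sub>+\<^sub>1 = 0\<close>; its usual form, expressing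
  \<open>\<mu>\<^sub>k\<^sub>-\<^sub>1\<close> for \<open>k = N, \<dots>, 1\<close>, is shifted here by one, i.e. the coefficients on the right-hand side
  are those for the index \<open>Suc k\<close>.\<close>

function downward_rec :: "nat \<Rightarrow> real \<Rightarrow> (nat \<Rightarrow> real) \<Rightarrow> nat \<Rightarrow> real" where
  "downward_rec N A \<eta> k =
     (if N \<le> k then 0
      else 1 / (1 + A / real (Suc k)) *
           (8 * \<eta> (Suc k) - 2 * downward_rec N A \<eta> (Suc k)
            - downward_rec N A \<eta> (Suc (Suc k)) * (1 - A / real (Suc k))))"
  by pat_completeness auto
termination
  by (relation "Wellfounded.measure (\<lambda>(N, A, \<eta>, k). N - k)") auto

declare downward_rec.simps [simp del]

definition integrated_coeff :: "real \<Rightarrow> (nat \<Rightarrow> real) \<Rightarrow> (nat \<Rightarrow> real) \<Rightarrow> nat \<Rightarrow> real" where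
  "integrated_coeff A \<eta> \<mu> k =
     (if k = 0 then 1 / A * (\<eta> 0 - 1/4 * (\<mu> 0 + \<mu> 1))
      else (\<mu> (k - 1) - \<mu> (k + 1)) / (8 * real k))"

primrec cheb_algorithm ::
  "nat \<Rightarrow> (nat \<Rightarrow> real) \<Rightarrow> (nat \<Rightarrow> real) \<Rightarrow> nat \<Rightarrow> nat \<Rightarrow> real" where
  "cheb_algorithm N a b 0 = (\<lambda>k. if k = 0 then 2 else 0)"
| "cheb_algorithm N a b (Suc m) =
     (let A = (\<Sum>i=1..Suc m. a i);
          v = node_value N (cheb_algorithm N a b m);
          \<eta> = product_coeff N (b (Suc m)) v;
          \<mu> = downward_rec N A \<eta>
      in integrated_coeff A \<eta> \<mu>)"

end

theory Submission
  imports Defs "HOL-Complex_Analysis.Complex_Analysis" "HOL-Real_Asymp.Real_Asymp"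
begin

text \<open>
  Let \<open>f\<^sub>m\<close> be the normalised function after \<open>m\<close> steps and \<open>A\<^sub>m = a\<^sub>1 + \<dots> + a\<^sub>m\<close>. It solves the Euler equation
  \<open>z f\<^sub>m' + A\<^sub>m f\<^sub>m = (1 - z)\<^bsup>b\<^sub>m - 1\<^esup> f\<^sub>m\<^sub>-\<^sub>1\<close>, so all functions involved are holomorphic off \<open>[1, \<infinity>)\<close>. The ellipse
  with foci \<open>0\<close> and \<open>1/2\<close> through \<open>1\<close>, which has parameter \<open>3 + 2\<surd>2\<close>, is contained in the closed unit disc;
  comparing Taylor coefficients at \<open>0\<close> with the nonnegative Chebyshev coefficients of the monomials shows
  that Chebyshev coefficients and truncation errors are \<open>O(r\<^sup>-\<^sup>k)\<close> for every \<open>r < 3 + 2\<surd>2\<close>. Discrete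
  orthogonality turns truncation into aliasing errors of the same order, and the downward recursion,
  which is the Euler equation on the level of coefficients, amplifies errors at most polynomially in \<open>N\<close>.
  Since \<open>3\<^bsup>8/5\<^esup> < 3 + 2\<surd>2\<close>, the polynomial factors are absorbed.
\<close>

section \<open>The iterated beta integrals on the slit plane\<close>

text \<open>The vertex of an ellipse with foci 0 and 1/2 and parameter r lies at 1/4 + (r + 1/r)/8.
  It reaches 1, the only finite singularity, when r + 1/r = 6, that is r = 3 + 2 sqrt 2, about
  5.828. Since 3^(8/5) is about 5.800, there is almost no room to lose in the geometric rate,
  whereas any polynomial loss in N is harmless. The numbers \<open>\<mu>\<^sub>k\<close> of the
  algorithm approximate the Chebyshev coefficients of the derivative \<open>f\<^sub>m'\<close>.
  Starting the recursion from zeros discards the true coefficients with indices N and N + 1 of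
  \<open>f\<^sub>m'\<close>. As \<open>f\<^sub>m'\<close> is holomorphic on the same slit plane,
  these have the same geometric size as every other truncation error. The integral in the problem
  enters only through its values on (0,1): these are computed by integrating out the largest
  variable last, and they fix all coefficients.\<close>

definition slit_plane :: "complex set" where
  "slit_plane = - (complex_of_real ` {1..})"

lemma open_slit_plane: "open slit_plane"
proof -
  have "complex_of_real ` {1..} = {z. Re z \<ge> 1} \<inter> {z. Im z = 0}"
    by (auto simp: complex_eq_iff image_iff intro!: bexI[of _ "Re _"])
  moreover have "closed ({z. Re z \<ge> 1} \<inter> {z. Im z = 0})"
    by (intro closed_Int closed_halfspace_Re_ge closed_hyperplane closed_Collect_eq continuous_intros)
  ultimately show ?thesis
    unfolding slit_plane_def by (metis open_Compl)
qed

text \<open>The slit plane is star-shaped about 0, so an average of g over the segment from 0 to z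
  makes sense for every z in it.\<close>

lemma slit_plane_scaled:
  assumes "z \<in> slit_plane" "0 \<le> t" "t \<le> 1"
  shows "complex_of_real t * z \<in> slit_plane"
proof (rule ccontr)
  assume "complex_of_real t * z \<notin> slit_plane"
  then obtain x where x: "x \<ge> 1" "complex_of_real t * z = complex_of_real x"
    by (auto simp: slit_plane_def)
  with assms have "t \<noteq> 0" by auto
  with x have "z = complex_of_real (x / t)"
    by (simp add: field_simps)
  moreover have "x / t \<ge> 1"
    using x assms \<open>t \<noteq> 0\<close> by (simp add: field_simps)
  ultimately show False
    using assms(1) unfolding slit_plane_def by blast
qed

lemma of_real_in_slit_plane: "x < 1 \<Longrightarrow> complex_of_real x \<in> slit_plane"
  by (auto simp: slit_plane_def)

lemma ball_subset_slit_plane: "ball 0 1 \<subseteq> slit_plane"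
  by (auto simp: slit_plane_def)

lemma holomorphic_one_minus_powr:
  "(\<lambda>z. (1 - z) powr complex_of_real c) holomorphic_on slit_plane"
proof (intro holomorphic_intros)
  fix z assume z: "z \<in> slit_plane"
  show "1 - z \<notin> \<real>\<^sub>\<le>\<^sub>0"
  proof
    assume "1 - z \<in> \<real>\<^sub>\<le>\<^sub>0"
    then obtain x where "x \<le> 0" "1 - z = complex_of_real x"
      by (auto simp: nonpos_Reals_def)
    then have "z = complex_of_real (1 - x)" "1 - x \<ge> 1"
      by (auto simp: algebra_simps)
    with z show False
      unfolding slit_plane_def by blast
  qed
qed

text \<open>Substituting \<open>s = u\<^sup>1\<^sup>/\<^sup>A\<close> in \<open>\<integral>\<^sub>0\<^sup>1 s\<^sup>A\<^sup>-\<^sup>1 g(zs) ds\<close> removes the singularity of the integrand at \<open>0\<close>.\<close>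

definition euler_integral :: "real \<Rightarrow> (complex \<Rightarrow> complex) \<Rightarrow> complex \<Rightarrow> complex" where
  "euler_integral A g z = of_real (1 / A) * integral {0..1} (\<lambda>u. g (of_real (u powr (1 / A)) * z))"

text \<open>Holomorphy is differentiation under the integral sign. The equation is the fundamental
  theorem of calculus for u g(u^e z) with e = 1/A: its derivative is g(u^e z) + e z u^e g'(u^e z),
  and the two integrals are multiples of the function and of its derivative.\<close>

lemma euler_integral_ode:
  assumes A: "A > 0" and holg: "g holomorphic_on slit_plane"
  shows euler_integral_holomorphic: "euler_integral A g holomorphic_on slit_plane"
    and "z \<in> slit_plane \<Longrightarrow>
           z * deriv (euler_integral A g) z + of_real A * euler_integral A g z = g z"
proof -
  define g' where "g' = deriv g"
  define e where "e = 1 / A"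
  have e: "e > 0" using A by (simp add: e_def)
  have g': "(g has_field_derivative g' z) (at z)" if "z \<in> slit_plane" for z
    unfolding g'_def using holg open_slit_plane that by (rule holomorphic_derivI)
  have contg: "continuous_on slit_plane g"
    using holg by (rule holomorphic_on_imp_continuous_on)
  have contg': "continuous_on slit_plane g'"
    unfolding g'_def using holomorphic_deriv[OF holg open_slit_plane]
    by (rule holomorphic_on_imp_continuous_on)
  have pe: "u powr e \<le> 1" "0 \<le> u powr e" if "u \<in> {0..1}" for u
    using powr_mono2[of e u 1] that e by auto
  have inS: "of_real (u powr e) * z \<in> slit_plane" if "u \<in> {0..1}" "z \<in> slit_plane" for u z
    using slit_plane_scaled[OF that(2)] pe[OF that(1)] by blast
  define dF where "dF z = integral {0..1} (\<lambda>u. of_real (u powr e) * g' (of_real (u powr e) * z))" for z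
  have cpow: "continuous_on {0..1} (\<lambda>u::real. complex_of_real (u powr e))"
    using e by (intro continuous_intros continuous_on_powr') auto
  have deriv: "((\<lambda>z. integral {0..1} (\<lambda>u. g (of_real (u powr e) * z))) has_field_derivative dF z) (at z)"
    if z: "z \<in> slit_plane" for z
  proof -
    obtain r where r: "r > 0" "ball z r \<subseteq> slit_plane"
      using open_slit_plane z by (auto simp: open_contains_ball)
    have "((\<lambda>z. integral (cbox 0 1) (\<lambda>u. g (of_real (u powr e) * z))) has_field_derivative
             integral (cbox 0 1) (\<lambda>u. of_real (u powr e) * g' (of_real (u powr e) * z))) (at z within ball z r)"
    proof (rule leibniz_rule_field_derivative)
      fix x u assume x: "x \<in> ball z r" and u: "u \<in> cbox (0::real) 1"
      have "((\<lambda>x. g (of_real (u powr e) * x)) has_field_derivative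
              g' (of_real (u powr e) * x) * of_real (u powr e)) (at x within ball z r)"
        by (rule DERIV_chain2[OF g']) (use x u r inS in \<open>auto intro!: derivative_eq_intros\<close>)
      then show "((\<lambda>x. g (of_real (u powr e) * x)) has_field_derivative
              of_real (u powr e) * g' (of_real (u powr e) * x)) (at x within ball z r)"
        by (simp add: mult.commute)
    next
      fix x assume x: "x \<in> ball z r"
      have "continuous_on (cbox 0 1) (\<lambda>u. g (of_real (u powr e) * x))"
        by (rule continuous_on_compose2[OF contg]) (use cpow x r inS in \<open>auto intro!: continuous_intros\<close>)
      then show "(\<lambda>u. g (of_real (u powr e) * x)) integrable_on cbox 0 1"
        by (rule integrable_continuous)
    next
      have c: "continuous_on (ball z r \<times> cbox (0::real) 1) (\<lambda>p. complex_of_real (snd p powr e))"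
        by (rule continuous_on_compose2[OF cpow]) (auto intro!: continuous_intros)
      have "continuous_on (ball z r \<times> cbox (0::real) 1)
              (\<lambda>p. of_real (snd p powr e) * g' (of_real (snd p powr e) * fst p))"
        by (intro continuous_on_mult c continuous_on_compose2[OF contg'] continuous_on_fst continuous_on_id)
           (use r inS in auto)
      then show "continuous_on (ball z r \<times> cbox (0::real) 1)
              (\<lambda>(x, u). of_real (u powr e) * g' (of_real (u powr e) * x))"
        by (simp add: case_prod_unfold)
    qed (use r in auto)
    then show ?thesis
      using r by (simp add: at_within_open[of z "ball z r"] dF_def)
  qed
  have deriv_f: "(euler_integral A g has_field_derivative of_real (1 / A) * dF z) (at z)"
    if "z \<in> slit_plane" for z
    unfolding euler_integral_def[abs_def] e_def[symmetric] by (intro DERIV_cmult deriv that)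
  then show "euler_integral A g holomorphic_on slit_plane"
    by (auto simp: holomorphic_on_open[OF open_slit_plane])
  assume z: "z \<in> slit_plane"
  define G where "G u = g (of_real (u powr e) * z)" for u
  define H where "H u = of_real (u powr e) * g' (of_real (u powr e) * z)" for u
  have contG: "continuous_on {0..1} G"
    unfolding G_def
    by (rule continuous_on_compose2[OF contg]) (use cpow z inS in \<open>auto intro!: continuous_intros\<close>)
  have contH: "continuous_on {0..1} H"
    unfolding H_def
    by (intro continuous_on_mult cpow continuous_on_compose2[OF contg'] continuous_on_const)
       (use z inS in auto)
  have "((\<lambda>u. G u + of_real e * z * H u) has_integral (of_real 1 * G 1 - of_real 0 * G 0)) {0..1}"
  \<comment> \<open>Derivatives are taken at interior points only, because \<open>u powr e\<close>
    need not be differentiable at 0.\<close>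
  proof (rule fundamental_theorem_of_calculus_interior)
    show "continuous_on {0..1} (\<lambda>u. of_real u * G u)"
      by (intro continuous_intros contG)
    fix u :: real assume u: "u \<in> {0<..<1}"
    have "((\<lambda>u. u powr e) has_real_derivative e * u powr (e - 1)) (at u)"
      using u by (auto intro!: derivative_eq_intros)
    then have "((\<lambda>u. of_real (u powr e) * z) has_vector_derivative of_real (e * u powr (e - 1)) * z) (at u)"
      by (intro has_vector_derivative_mult_left has_vector_derivative_of_real)
    from field_vector_diff_chain_at[OF this g'[OF inS[OF _ z]]]
    have "(G has_vector_derivative of_real (e * u powr (e - 1)) * z * g' (of_real (u powr e) * z)) (at u)"
      using u by (simp add: o_def G_def[abs_def])
    then have "((\<lambda>u. of_real u * G u) has_vector_derivative
                 (of_real u * (of_real (e * u powr (e - 1)) * z * g' (of_real (u powr e) * z)) + of_real 1 * G u)) (at u)"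
      by (intro has_vector_derivative_mult has_vector_derivative_of_real) (auto intro: DERIV_ident)
    moreover have "u * u powr (e - 1) = u powr e"
      using u by (simp add: powr_diff)
    then have "of_real u * (of_real (u powr (e - 1)) :: complex) = of_real (u powr e)"
      by (metis of_real_mult)
    then have "of_real u * (of_real (e * u powr (e - 1)) * z * g' (of_real (u powr e) * z)) + of_real 1 * G u
        = G u + of_real e * z * H u"
      unfolding H_def of_real_mult by (simp add: algebra_simps) 
    ultimately show "((\<lambda>u. of_real u * G u) has_vector_derivative G u + of_real e * z * H u) (at u)"
      by (simp only:)
  qed auto
  then have "g z = integral {0..1} (\<lambda>u. G u + of_real e * z * H u)"
    by (simp add: integral_unique G_def)
  also have "\<dots> = integral {0..1} G + of_real e * z * integral {0..1} H"
    using contG contH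
    by (subst Henstock_Kurzweil_Integration.integral_add)
       (auto intro!: integrable_continuous_interval continuous_intros)
  also have "integral {0..1} G = of_real A * euler_integral A g z"
    using A by (simp add: euler_integral_def G_def[abs_def] e_def)
  also have "of_real e * z * integral {0..1} H = z * deriv (euler_integral A g) z"
    using DERIV_imp_deriv[OF deriv_f[OF z]] by (simp add: dF_def H_def[abs_def] e_def)
  finally show "z * deriv (euler_integral A g) z + of_real A * euler_integral A g z = g z"
    by simp
qed

text \<open>Integrating factor: (t^A \<phi>)' = t^(A-1) (t \<phi>' + A \<phi>), and t^A \<phi>
  vanishes at 0 because A > 0. Applied to real and imaginary parts, this returns from the
  differential equation to integrals over [0,x].\<close>

lemma ode_has_integral:
  fixes \<phi> \<phi>' \<gamma> :: "real \<Rightarrow> real"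
  assumes A: "A > 0" and x: "0 \<le> x" and cont: "continuous_on {0..x} \<phi>"
    and deriv: "\<And>t. t \<in> {0<..<x} \<Longrightarrow> (\<phi> has_real_derivative \<phi>' t) (at t)"
    and ode: "\<And>t. t \<in> {0<..<x} \<Longrightarrow> t * \<phi>' t + A * \<phi> t = \<gamma> t"
  shows "((\<lambda>t. t powr (A - 1) * \<gamma> t) has_integral x powr A * \<phi> x) {0..x}"
proof -
  have "((\<lambda>t. t powr (A - 1) * \<gamma> t) has_integral x powr A * \<phi> x - 0 powr A * \<phi> 0) {0..x}"
  proof (rule fundamental_theorem_of_calculus_interior)
    show "continuous_on {0..x} (\<lambda>t. t powr A * \<phi> t)"
      using A by (intro continuous_intros continuous_on_powr' cont) auto
    fix t assume t: "t \<in> {0<..<x}"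
    have "((\<lambda>t. t powr A * \<phi> t) has_real_derivative (A * t powr (A - 1) * \<phi> t + \<phi>' t * t powr A)) (at t)"
      using t by (auto intro!: derivative_eq_intros deriv)
    moreover have "A * t powr (A - 1) * \<phi> t + \<phi>' t * t powr A = t powr (A - 1) * \<gamma> t"
      using t ode[OF t, symmetric] by (simp add: powr_diff field_simps)
    ultimately show "((\<lambda>t. t powr A * \<phi> t) has_vector_derivative t powr (A - 1) * \<gamma> t) (at t)"
      by (simp add: has_real_derivative_iff_has_vector_derivative)
  qed (use x in auto)
  then show ?thesis by simp
qed

lemma has_real_derivative_Re_of_real:
  assumes "(f has_field_derivative D) (at (complex_of_real x))"
  shows "((\<lambda>x. Re (f (complex_of_real x))) has_real_derivative Re D) (at x)"
  using bounded_linear.has_vector_derivative[OF bounded_linear_Re has_vector_derivative_real_field[OF assms]]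
  by (simp add: has_real_derivative_iff_has_vector_derivative)

lemma has_real_derivative_Im_of_real:
  assumes "(f has_field_derivative D) (at (complex_of_real x))"
  shows "((\<lambda>x. Im (f (complex_of_real x))) has_real_derivative Im D) (at x)"
  using bounded_linear.has_vector_derivative[OF bounded_linear_Im has_vector_derivative_real_field[OF assms]]
  by (simp add: has_real_derivative_iff_has_vector_derivative)

text \<open>The analytic continuation of the normalised integral, built one variable at a time.
  Substituting x = z s for the largest variable cancels the prefactor and leaves the integral of
  s^(A-1) g(zs) over [0,1], with g the weight times the function of lower order.\<close>

primrec beta_fun :: "(nat \<Rightarrow> real) \<Rightarrow> (nat \<Rightarrow> real) \<Rightarrow> nat \<Rightarrow> complex \<Rightarrow> complex" where
  "beta_fun a b 0 = (\<lambda>_. 1)"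
| "beta_fun a b (Suc m) =
     euler_integral (\<Sum>i=1..Suc m. a i)
       (\<lambda>z. (1 - z) powr complex_of_real (b (Suc m) - 1) * beta_fun a b m z)"

lemma sum_pos_upto_Suc:
  fixes a :: "nat \<Rightarrow> real"
  assumes "\<And>i. 1 \<le> i \<Longrightarrow> i \<le> Suc m \<Longrightarrow> a i > 0"
  shows "(\<Sum>i=1..Suc m. a i) > 0"
  using assms by (intro sum_pos) auto

lemma holomorphic_beta_fun:
  assumes "\<And>i. 1 \<le> i \<Longrightarrow> i \<le> m \<Longrightarrow> a i > 0"
  shows "beta_fun a b m holomorphic_on slit_plane"
  using assms
proof (induction m)
  case (Suc m)
  then show ?case
    unfolding beta_fun.simps
    by (intro euler_integral_holomorphic sum_pos_upto_Suc holomorphic_on_mult holomorphic_one_minus_powr)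
       auto
qed auto

lemma beta_fun_ode:
  assumes "\<And>i. 1 \<le> i \<Longrightarrow> i \<le> Suc m \<Longrightarrow> a i > 0" and "z \<in> slit_plane"
  shows "z * deriv (beta_fun a b (Suc m)) z + of_real (\<Sum>i=1..Suc m. a i) * beta_fun a b (Suc m) z
         = (1 - z) powr complex_of_real (b (Suc m) - 1) * beta_fun a b m z"
  unfolding beta_fun.simps
  by (intro euler_integral_ode(2) sum_pos_upto_Suc holomorphic_on_mult holomorphic_one_minus_powr
        holomorphic_beta_fun assms) auto

section \<open>The iterated functions on the real axis\<close>

definition beta_real :: "(nat \<Rightarrow> real) \<Rightarrow> (nat \<Rightarrow> real) \<Rightarrow> nat \<Rightarrow> real \<Rightarrow> real" where
  "beta_real a b m x = Re (beta_fun a b m (complex_of_real x))"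

definition beta_real' :: "(nat \<Rightarrow> real) \<Rightarrow> (nat \<Rightarrow> real) \<Rightarrow> nat \<Rightarrow> real \<Rightarrow> real" where
  "beta_real' a b m x = Re (deriv (beta_fun a b m) (complex_of_real x))"

lemma one_minus_powr_of_real:
  "x < 1 \<Longrightarrow> (1 - complex_of_real x) powr complex_of_real c = complex_of_real ((1 - x) powr c)"
  by (metis of_real_1 of_real_diff diff_ge_0_iff_ge less_imp_le powr_of_real)

lemma continuous_on_holomorphic_of_real:
  assumes "f holomorphic_on slit_plane" "\<And>x. x \<in> S \<Longrightarrow> x < 1"
  shows "continuous_on S (\<lambda>x. f (complex_of_real x))"
  by (rule continuous_on_compose2[OF holomorphic_on_imp_continuous_on[OF assms(1)]])
     (use assms(2) of_real_in_slit_plane in \<open>auto intro!: continuous_intros\<close>)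

lemma beta_real_deriv:
  assumes "\<And>i. 1 \<le> i \<Longrightarrow> i \<le> m \<Longrightarrow> a i > 0" "x < 1"
  shows "(beta_real a b m has_real_derivative beta_real' a b m x) (at x)"
  unfolding beta_real_def[abs_def] beta_real'_def
  by (intro has_real_derivative_Re_of_real holomorphic_derivI[OF holomorphic_beta_fun open_slit_plane]
        of_real_in_slit_plane assms)

lemma beta_real_ode:
  assumes "\<And>i. 1 \<le> i \<Longrightarrow> i \<le> Suc m \<Longrightarrow> a i > 0" "x < 1"
  shows "x * beta_real' a b (Suc m) x + (\<Sum>i=1..Suc m. a i) * beta_real a b (Suc m) x
         = (1 - x) powr (b (Suc m) - 1) * beta_real a b m x"
  using arg_cong[OF beta_fun_ode[OF assms(1) of_real_in_slit_plane[OF assms(2)]], where f = Re and b1 = b]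
  unfolding one_minus_powr_of_real[OF assms(2)] beta_real_def beta_real'_def
  by (simp del: beta_fun.simps of_real_sum sum.cl_ivl_Suc)

text \<open>By induction the right-hand side of the Euler equation is real on (0,1). The imaginary
  part therefore solves the homogeneous equation, and continuity at 0 leaves only the zero
  solution.\<close>

lemma beta_fun_real:
  assumes "\<And>i. 1 \<le> i \<Longrightarrow> i \<le> m \<Longrightarrow> a i > 0" "0 < x" "x < 1"
  shows "Im (beta_fun a b m (complex_of_real x)) = 0"
  using assms
proof (induction m arbitrary: x)
  case (Suc m)
  define A where "A = (\<Sum>i=1..Suc m. a i)"
  have A: "A > 0" using Suc.prems sum_pos_upto_Suc unfolding A_def by blast
  have "((\<lambda>t. t powr (A - 1) * 0) has_integral x powr A * Im (beta_fun a b (Suc m) (complex_of_real x))) {0..x}"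
  proof (rule ode_has_integral)
    show "continuous_on {0..x} (\<lambda>t. Im (beta_fun a b (Suc m) (complex_of_real t)))"
      by (intro continuous_on_Im continuous_on_holomorphic_of_real holomorphic_beta_fun Suc.prems)
         (use Suc.prems in auto)
    fix t assume t: "t \<in> {0<..<x}"
    show "((\<lambda>t. Im (beta_fun a b (Suc m) (complex_of_real t))) has_real_derivative
            Im (deriv (beta_fun a b (Suc m)) (complex_of_real t))) (at t)"
      by (intro has_real_derivative_Im_of_real holomorphic_derivI[OF holomorphic_beta_fun open_slit_plane]
            of_real_in_slit_plane Suc.prems) (use t Suc.prems in auto)
    have t1: "t < 1" using t Suc.prems by auto
    have "Im (beta_fun a b m (complex_of_real t)) = 0"
      using Suc.prems t by (intro Suc.IH) auto
    then show "t * Im (deriv (beta_fun a b (Suc m)) (complex_of_real t)) +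
          A * Im (beta_fun a b (Suc m) (complex_of_real t)) = 0"
      using arg_cong[OF beta_fun_ode[OF Suc.prems(1) of_real_in_slit_plane[OF t1]], where f = Im and b1 = b]
      unfolding one_minus_powr_of_real[OF t1] A_def
      by (simp del: beta_fun.simps of_real_sum sum.cl_ivl_Suc)
  qed (use A Suc.prems in auto)
  then have "x powr A * Im (beta_fun a b (Suc m) (complex_of_real x)) = 0"
    by (simp add: has_integral_iff)
  then show ?case using Suc.prems by auto
qed auto

lemma beta_real_has_integral:
  assumes "\<And>i. 1 \<le> i \<Longrightarrow> i \<le> Suc m \<Longrightarrow> a i > 0" "0 \<le> x" "x < 1"
  defines "A \<equiv> (\<Sum>i=1..Suc m. a i)"
  shows "((\<lambda>t. t powr (A - 1) * ((1 - t) powr (b (Suc m) - 1) * beta_real a b m t))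
           has_integral x powr A * beta_real a b (Suc m) x) {0..x}"
proof (rule ode_has_integral)
  show "A > 0" using assms(1) sum_pos_upto_Suc unfolding A_def by blast
  show "continuous_on {0..x} (beta_real a b (Suc m))"
    by (rule DERIV_continuous_on[OF has_field_derivative_at_within[OF beta_real_deriv]])
       (use assms(1,3) in auto)
  fix t assume "t \<in> {0<..<x}"
  then have t: "t < 1" using assms(3) by auto
  show "(beta_real a b (Suc m) has_real_derivative beta_real' a b (Suc m) t) (at t)"
    by (rule beta_real_deriv[OF assms(1) t])
  show "t * beta_real' a b (Suc m) t + A * beta_real a b (Suc m) t =
          (1 - t) powr (b (Suc m) - 1) * beta_real a b m t"
    unfolding A_def by (rule beta_real_ode[OF assms(1) t])
qed (use assms in auto)

text \<open>This allows the passage to \<open>ennreal\<close> and back in the multidimensional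
  integral without loss.\<close>

lemma beta_real_nonneg:
  assumes "\<And>i. 1 \<le> i \<Longrightarrow> i \<le> m \<Longrightarrow> a i > 0" "0 < x" "x < 1"
  shows "beta_real a b m x \<ge> 0"
  using assms
proof (induction m arbitrary: x)
  case 0
  then show ?case by (simp add: beta_real_def)
next
  case (Suc m)
  define A where "A = (\<Sum>i=1..Suc m. a i)"
  have "0 \<le> t powr (A - 1) * ((1 - t) powr (b (Suc m) - 1) * beta_real a b m t)"
    if "t \<in> {0..x}" for t
    \<comment> \<open>The induction hypothesis is silent at t = 0, where the factor
      \<open>0 powr (A - 1)\<close> is 0 by convention.\<close>
    using Suc.IH[of t] Suc.prems that by (cases "t = 0") auto
  moreover have "((\<lambda>t. t powr (A - 1) * ((1 - t) powr (b (Suc m) - 1) * beta_real a b m t))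
           has_integral x powr A * beta_real a b (Suc m) x) {0..x}"
    unfolding A_def using Suc.prems by (intro beta_real_has_integral) auto
  ultimately have "0 \<le> x powr A * beta_real a b (Suc m) x"
    by (rule has_integral_nonneg[rotated])
  then show ?case using Suc.prems by (simp add: zero_le_mult_iff)
qed

section \<open>The multidimensional integral as an iterated integral\<close>

definition ordered_box :: "nat \<Rightarrow> real \<Rightarrow> (nat \<Rightarrow> real) set" where
  "ordered_box n z = {x. (\<forall>i\<in>{1..n}. 0 \<le> x i \<and> x i \<le> z) \<and>
                      (\<forall>i\<in>{1..n}. \<forall>j\<in>{1..n}. i \<le> j \<longrightarrow> x i \<le> x j)}"

definition beta_weight :: "(nat \<Rightarrow> real) \<Rightarrow> (nat \<Rightarrow> real) \<Rightarrow> nat \<Rightarrow> (nat \<Rightarrow> real) \<Rightarrow> real" where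
  "beta_weight a b n x = (\<Prod>i\<in>{1..n}. x i powr (a i - 1) * (1 - x i) powr (b i - 1))"

lemma beta_weight_nonneg: "0 \<le> beta_weight a b n x"
  unfolding beta_weight_def by (intro prod_nonneg) auto

text \<open>The last coordinate is the largest, so fixing it turns it into the upper limit for the
  others. This makes the inner integral an instance of the same problem with one variable
  fewer.\<close>

lemma ordered_box_update:
  "x(Suc m := y) \<in> ordered_box (Suc m) z \<longleftrightarrow> y \<in> {0..z} \<and> x \<in> ordered_box m y"
proof -
  define x' where "x' = x(Suc m := y)"
  have x': "x' (Suc m) = y" "\<And>i. i \<in> {1..m} \<Longrightarrow> x' i = x i"
    by (auto simp: x'_def)
  have set: "i \<in> {1..Suc m} \<longleftrightarrow> i = Suc m \<or> i \<in> {1..m}" for i by auto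
  have "x' \<in> ordered_box (Suc m) z" if y: "y \<in> {0..z}" and x: "x \<in> ordered_box m y"
  proof -
    have "0 \<le> x' i \<and> x' i \<le> y" if "i \<in> {1..Suc m}" for i
      using that y x x' unfolding set ordered_box_def by force
    moreover have "x' i \<le> x' j" if "i \<in> {1..Suc m}" "j \<in> {1..Suc m}" "i \<le> j" for i j
    proof (cases "j = Suc m")
      case True
      then show ?thesis using calculation[OF that(1)] x'(1) by simp
    next
      case False
      then have "i \<in> {1..m}" "j \<in> {1..m}" using that by auto
      then show ?thesis using x that x'(2) unfolding ordered_box_def by auto
    qed
    moreover have "y \<le> z" using y by simp
    ultimately show ?thesis
      unfolding ordered_box_def by (blast intro: order_trans)
  qed
  moreover have "y \<in> {0..z} \<and> x \<in> ordered_box m y" if L: "x' \<in> ordered_box (Suc m) z"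
  proof -
    have bounds: "0 \<le> x' i" "x' i \<le> z" if "i \<in> {1..Suc m}" for i
      using L that unfolding ordered_box_def by blast+
    have mono: "x' i \<le> x' j" if "i \<in> {1..Suc m}" "j \<in> {1..Suc m}" "i \<le> j" for i j
      using L that unfolding ordered_box_def by blast
    have "0 \<le> x i \<and> x i \<le> y" if "i \<in> {1..m}" for i
      using bounds(1)[of i] mono[of i "Suc m"] that x' by auto
    moreover have "x i \<le> x j" if "i \<in> {1..m}" "j \<in> {1..m}" "i \<le> j" for i j
      using mono[of i j] that x' by auto
    moreover have "y \<in> {0..z}"
      using bounds[of "Suc m"] x' by auto
    ultimately show ?thesis
      unfolding ordered_box_def by blast
  qed
  ultimately show ?thesis unfolding x'_def by blast
qed

lemma beta_weight_update:
  "beta_weight a b (Suc m) (x(Suc m := y)) =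
     y powr (a (Suc m) - 1) * (1 - y) powr (b (Suc m) - 1) * beta_weight a b m x"
proof -
  have "(\<Prod>i\<in>{1..m}. (x(Suc m := y)) i powr (a i - 1) * (1 - (x(Suc m := y)) i) powr (b i - 1)) =
    (\<Prod>i\<in>{1..m}. x i powr (a i - 1) * (1 - x i) powr (b i - 1))"
    by (intro prod.cong) auto
  then show ?thesis
    unfolding beta_weight_def by (simp add: mult.commute)
qed

lemma measurable_indicator_ordered_box:
  "(\<lambda>x. indicator (ordered_box n z) x :: real) \<in> borel_measurable (\<Pi>\<^sub>M i\<in>{1..n}. lborel)"
proof -
  define M where "M = (\<Pi>\<^sub>M i\<in>{1..n}. (lborel :: real measure))"
  have comp: "(\<lambda>x. x i) \<in> borel_measurable M" if "i \<in> {1..n}" for i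
    unfolding M_def using that by measurable
  have box: "{x \<in> space M. 0 \<le> x i \<and> x i \<le> z} \<in> sets M" if "i \<in> {1..n}" for i
    using comp[OF that, measurable] by measurable
  have ord: "{x \<in> space M. i \<le> j \<longrightarrow> x i \<le> x j} \<in> sets M" if "i \<in> {1..n}" "j \<in> {1..n}" for i j
    using borel_measurable_le[OF comp[OF that(1)] comp[OF that(2)]] by (cases "i \<le> j") simp_all
  have "{x \<in> space M. \<forall>i\<in>{1..n}. 0 \<le> x i \<and> x i \<le> z} \<in> sets M"
    by (rule sets.sets_Collect_finite_All[OF box]) simp_all
  moreover have "{x \<in> space M. \<forall>i\<in>{1..n}. \<forall>j\<in>{1..n}. i \<le> j \<longrightarrow> x i \<le> x j} \<in> sets M"
    by (rule sets.sets_Collect_finite_All[OF sets.sets_Collect_finite_All[OF ord]]) simp_all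
  ultimately have "{x \<in> space M. x \<in> ordered_box n z} \<in> sets M"
    unfolding ordered_box_def mem_Collect_eq by (rule sets.sets_Collect_conj[rotated])
  then show ?thesis
    unfolding M_def[symmetric] by (rule borel_measurable_indicator')
qed

lemma measurable_beta_weight:
  "beta_weight a b n \<in> borel_measurable (\<Pi>\<^sub>M i\<in>{1..n}. lborel)"
  unfolding beta_weight_def[abs_def] by measurable

lemma measurable_ordered_integrand:
  "(\<lambda>x. ennreal (indicator (ordered_box n z) x * beta_weight a b n x))
     \<in> borel_measurable (\<Pi>\<^sub>M i\<in>{1..n}. lborel)"
  by (intro measurable_compose[OF _ measurable_ennreal] borel_measurable_times
        measurable_indicator_ordered_box measurable_beta_weight)

text \<open>Tonelli with the largest variable y outermost. The inner integral contributes the power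
  of y with exponent \<open>a 1 + ... + a m\<close>, which merges with
  \<open>y powr (a (Suc m) - 1)\<close> into \<open>y powr (A - 1)\<close>; what remains is the
  one-dimensional integral of \<open>beta_real_has_integral\<close>. Nonnegative integrals need no
  prior integrability argument.\<close>

lemma nn_integral_ordered_box:
  assumes "\<And>i. 1 \<le> i \<Longrightarrow> i \<le> m \<Longrightarrow> a i > 0" "0 < z" "z < 1"
  shows "(\<integral>\<^sup>+x. ennreal (indicator (ordered_box m z) x * beta_weight a b m x) \<partial>(\<Pi>\<^sub>M i\<in>{1..m}. lborel))
         = ennreal (z powr (\<Sum>i=1..m. a i) * beta_real a b m z)"
  using assms
proof (induction m arbitrary: z)
  case 0
  interpret product_sigma_finite "\<lambda>_::nat. lborel :: real measure" ..
  show ?case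
    using 0 by (simp add: PiM_empty nn_integral_count_space_finite beta_real_def ordered_box_def beta_weight_def)
next
  case (Suc m)
  interpret product_sigma_finite "\<lambda>_::nat. lborel :: real measure" ..
  define A where "A = (\<Sum>i=1..Suc m. a i)"
  define w where "w y = y powr (a (Suc m) - 1) * (1 - y) powr (b (Suc m) - 1)" for y
  have *: "{1..Suc m} = insert (Suc m) {1..m}" by auto
  have "(\<integral>\<^sup>+x. ennreal (indicator (ordered_box (Suc m) z) x * beta_weight a b (Suc m) x)
            \<partial>(\<Pi>\<^sub>M i\<in>{1..Suc m}. lborel))
    = (\<integral>\<^sup>+y. \<integral>\<^sup>+x. ennreal (indicator (ordered_box (Suc m) z) (x(Suc m := y)) *
          beta_weight a b (Suc m) (x(Suc m := y))) \<partial>(\<Pi>\<^sub>M i\<in>{1..m}. lborel) \<partial>lborel)"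
    unfolding *
  proof (rule product_nn_integral_insert_rev)
    show "(\<lambda>x. ennreal (indicator (ordered_box (Suc m) z) x * beta_weight a b (Suc m) x))
        \<in> borel_measurable (\<Pi>\<^sub>M i\<in>insert (Suc m) {1..m}. lborel)"
      unfolding *[symmetric] by (rule measurable_ordered_integrand)
  qed auto
  also have "\<dots> = (\<integral>\<^sup>+y. ennreal (indicator {0..z} y * w y) *
      (\<integral>\<^sup>+x. ennreal (indicator (ordered_box m y) x * beta_weight a b m x) \<partial>(\<Pi>\<^sub>M i\<in>{1..m}. lborel)) \<partial>lborel)"
  proof (intro nn_integral_cong)
    fix y
    have "ennreal (indicator (ordered_box (Suc m) z) (x(Suc m := y)) * beta_weight a b (Suc m) (x(Suc m := y)))
      = ennreal (indicator {0..z} y * w y) * ennreal (indicator (ordered_box m y) x * beta_weight a b m x)" for x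
      by (subst ennreal_mult[symmetric])
         (auto simp: w_def beta_weight_nonneg indicator_def ordered_box_update beta_weight_update)
    then show "(\<integral>\<^sup>+x. ennreal (indicator (ordered_box (Suc m) z) (x(Suc m := y)) *
          beta_weight a b (Suc m) (x(Suc m := y))) \<partial>(\<Pi>\<^sub>M i\<in>{1..m}. lborel))
      = ennreal (indicator {0..z} y * w y) *
      (\<integral>\<^sup>+x. ennreal (indicator (ordered_box m y) x * beta_weight a b m x) \<partial>(\<Pi>\<^sub>M i\<in>{1..m}. lborel))"
      by (simp only: nn_integral_cmult[OF measurable_ordered_integrand])
  qed
  also have "\<dots> = (\<integral>\<^sup>+y. ennreal (indicator {0..z} y *
        (y powr (A - 1) * ((1 - y) powr (b (Suc m) - 1) * beta_real a b m y))) \<partial>lborel)"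
  proof (rule nn_integral_cong_AE)
    \<comment> \<open>The induction hypothesis covers positive upper limits only; the exceptional
      point 0 is a null set.\<close>
    have "AE y in lborel. y \<noteq> (0::real)"
      by (rule AE_lborel_singleton)
    then show "AE y in lborel. ennreal (indicator {0..z} y * w y) *
      (\<integral>\<^sup>+x. ennreal (indicator (ordered_box m y) x * beta_weight a b m x) \<partial>(\<Pi>\<^sub>M i\<in>{1..m}. lborel))
      = ennreal (indicator {0..z} y *
        (y powr (A - 1) * ((1 - y) powr (b (Suc m) - 1) * beta_real a b m y)))"
    proof eventually_elim
      case (elim y)
      show ?case
      proof (cases "y \<in> {0..z}")
        case True
        with elim Suc.prems have y: "0 < y" "y < 1" by auto
        have "(\<integral>\<^sup>+x. ennreal (indicator (ordered_box m y) x * beta_weight a b m x) \<partial>(\<Pi>\<^sub>M i\<in>{1..m}. lborel))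
          = ennreal (y powr (\<Sum>i=1..m. a i) * beta_real a b m y)"
          using y Suc.prems by (intro Suc.IH) auto
        moreover have "0 \<le> beta_real a b m y"
          using y Suc.prems by (intro beta_real_nonneg) auto
        moreover have "0 \<le> w y" by (simp add: w_def)
        moreover have "y powr (A - 1) = y powr (a (Suc m) - 1) * y powr (\<Sum>i=1..m. a i)"
          by (simp add: A_def flip: powr_add) (simp add: algebra_simps)
        then have "w y * (y powr (\<Sum>i=1..m. a i) * beta_real a b m y) =
            y powr (A - 1) * ((1 - y) powr (b (Suc m) - 1) * beta_real a b m y)"
          unfolding w_def by (simp only: mult_ac)
        ultimately show ?thesis
          using True by (simp flip: ennreal_mult)
      qed auto
    qed
  qed
  also have "\<dots> = ennreal (z powr A * beta_real a b (Suc m) z)"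
  proof (rule nn_integral_has_integral_lebesgue)
    show "((\<lambda>y. y powr (A - 1) * ((1 - y) powr (b (Suc m) - 1) * beta_real a b m y))
      has_integral z powr A * beta_real a b (Suc m) z) {0..z}"
      unfolding A_def using Suc.prems by (intro beta_real_has_integral) auto
    fix y assume y: "y \<in> {0..z}"
    show "0 \<le> y powr (A - 1) * ((1 - y) powr (b (Suc m) - 1) * beta_real a b m y)"
      using beta_real_nonneg[of m a y b] Suc.prems y by (cases "y = 0") auto
  qed
  finally show ?case unfolding A_def .
qed

lemma inc_beta_eq:
  assumes "\<And>i. 1 \<le> i \<Longrightarrow> i \<le> n \<Longrightarrow> a i > 0" "0 < z" "z < 1"
  shows "inc_beta n a b z = z powr (\<Sum>i=1..n. a i) * beta_real a b n z"
proof -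
  have "inc_beta n a b z =
      (LINT x | (\<Pi>\<^sub>M i\<in>{1..n}. lborel). indicator (ordered_box n z) x * beta_weight a b n x)"
    unfolding inc_beta_def ordered_box_def beta_weight_def ..
  also have "\<dots> = enn2real (\<integral>\<^sup>+x. ennreal (indicator (ordered_box n z) x * beta_weight a b n x)
       \<partial>(\<Pi>\<^sub>M i\<in>{1..n}. lborel))"
    by (intro integral_eq_nn_integral borel_measurable_times measurable_indicator_ordered_box
          measurable_beta_weight) (simp add: beta_weight_nonneg)
  also have "\<dots> = z powr (\<Sum>i=1..n. a i) * beta_real a b n z"
    using nn_integral_ordered_box[OF assms] beta_real_nonneg[OF assms] by simp
  finally show ?thesis .
qed

lemma norm_beta_eq:
  assumes "\<And>i. 1 \<le> i \<Longrightarrow> i \<le> n \<Longrightarrow> a i > 0" "0 < z" "z < 1"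
  shows "norm_beta n a b z = beta_real a b n z"
  using inc_beta_eq[OF assms] assms(2) by (simp add: norm_beta_def powr_minus field_simps)

text \<open>\<open>beta_fun\<close> witnesses that the property under \<open>SOME\<close> is
  satisfiable. Whichever function is chosen, the property itself prescribes its values on (0,1), and
  only those are used below.\<close>

lemma beta_ext_eq:
  assumes "\<And>i. 1 \<le> i \<Longrightarrow> i \<le> n \<Longrightarrow> a i > 0" "0 < x" "x < 1"
  shows "Re (beta_ext n a b (complex_of_real x)) = beta_real a b n x"
proof -
  let ?P = "\<lambda>f. f analytic_on - (complex_of_real ` {1..}) \<and>
              (\<forall>z\<in>{0<..<1}. f (complex_of_real z) = complex_of_real (norm_beta n a b z))"
  have "?P (beta_fun a b n)"
    using holomorphic_beta_fun[OF assms(1)] norm_beta_eq[OF assms(1)] beta_fun_real[OF assms(1)]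
      open_slit_plane
    by (auto simp: analytic_on_open slit_plane_def beta_real_def complex_eq_iff)
  then have "?P (beta_ext n a b)"
    unfolding beta_ext_def by (rule someI[where P = ?P])
  then show ?thesis
    using assms norm_beta_eq[OF assms(1)] by simp
qed

section \<open>Discrete and continuous cosine coefficients\<close>

text \<open>The product formula, with |k - l| written as \<open>max k l - min k l\<close> to keep it
  a natural number. Discrete and continuous orthogonality thereby both reduce to single
  cosines.\<close>

lemma cos_times_cos_multiples:
  "cos (real l * t) * cos (real k * t) =
      cos (real (k + l) * t) / 2 + cos (real (max k l - min k l) * t) / 2"
proof -
  have "cos (real (max k l - min k l) * t) = cos (real k * t - real l * t)"
  proof (cases "k \<le> l")
    case True
    have "cos (real k * t - real l * t) = cos (real l * t - real k * t)"
      by (metis cos_minus minus_diff_eq)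
    then show ?thesis using True by (simp add: of_nat_diff left_diff_distrib)
  qed (simp add: of_nat_diff left_diff_distrib)
  then show ?thesis
    by (simp add: cos_add cos_diff distrib_right field_simps)
qed

text \<open>With h = m pi/(N + 1), the arguments are the midpoints (j + 1/2) h. Multiplication by 2
  sin(h/2) makes the sum telescope to sin(m pi) - sin 0 = 0, and the bounds on m put h/2 strictly
  between 0 and pi, so the multiplier is nonzero.\<close>

lemma sum_cos_cheb_angle:
  assumes "0 < m" "m < 2 * (N + 1)"
  shows "(\<Sum>j=0..N. cos (real m * cheb_angle N j)) = 0"
proof -
  define h where "h = real m * pi / (real N + 1)"
  have h: "0 < h / 2" "h / 2 < pi"
  proof -
    show "0 < h / 2" using assms by (simp add: h_def)
    have "real m < 2 * (real N + 1)" using assms by auto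
    from mult_strict_left_mono[OF this pi_gt_zero]
    show "h / 2 < pi" by (simp add: h_def field_simps)
  qed
  have "2 * sin (h / 2) * cos (real m * cheb_angle N j) = sin (real (Suc j) * h) - sin (real j * h)" for j
  proof -
    have "sin (real (Suc j) * h) - sin (real j * h) =
        2 * sin ((real (Suc j) * h - real j * h) / 2) * cos ((real (Suc j) * h + real j * h) / 2)"
      by (rule sin_diff_sin)
    also have "(real (Suc j) * h - real j * h) / 2 = h / 2"
      by (simp add: algebra_simps)
    also have "(real (Suc j) * h + real j * h) / 2 = real m * cheb_angle N j"
    proof -
      define d where "d = pi / (real N + 1)"
      have "h = real m * d" "cheb_angle N j = d * (real j + 1 / 2)"
        by (simp_all add: h_def cheb_angle_def d_def)
      then show ?thesis by (simp add: algebra_simps)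
    qed
    finally show ?thesis by simp
  qed
  then have "2 * sin (h / 2) * (\<Sum>j=0..N. cos (real m * cheb_angle N j)) =
      (\<Sum>j=0..N. sin (real (Suc j) * h) - sin (real j * h))"
    by (simp add: sum_distrib_left)
  also have "\<dots> = sin (real (Suc N) * h) - sin (real 0 * h)"
    by (subst sum_Suc_diff) auto
  also have "real (Suc N) * h = real m * pi"
    by (simp add: h_def field_simps)
  finally show ?thesis
    using sin_gt_zero[OF h] by simp
qed

definition discrete_coeff :: "nat \<Rightarrow> (nat \<Rightarrow> real) \<Rightarrow> nat \<Rightarrow> real" where
  "discrete_coeff N y k = 2 / (real N + 1) * (\<Sum>j=0..N. y j * cos (real k * cheb_angle N j))"

definition cos_partial_sum :: "nat \<Rightarrow> (nat \<Rightarrow> real) \<Rightarrow> real \<Rightarrow> real" where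
  "cos_partial_sum N c \<theta> = c 0 / 2 + (\<Sum>k=1..N. c k * cos (real k * \<theta>))"

lemma discrete_orthogonality:
  assumes "k \<le> N" "l \<le> N"
  shows "discrete_coeff N (\<lambda>j. cos (real l * cheb_angle N j)) k =
           (if k = l then if k = 0 then 2 else 1 else 0)"
proof -
  have eq: "(\<Sum>j=0..N. cos (real l * cheb_angle N j) * cos (real k * cheb_angle N j)) =
      (\<Sum>j=0..N. cos (real (k + l) * cheb_angle N j)) / 2 +
      (\<Sum>j=0..N. cos (real (max k l - min k l) * cheb_angle N j)) / 2"
    by (simp add: cos_times_cos_multiples sum.distrib sum_divide_distrib)
  show ?thesis
  proof (cases "k = l")
    case True
    then show ?thesis
      using sum_cos_cheb_angle[of "k + l" N] assms
      unfolding discrete_coeff_def eq by (cases "k = 0") (auto simp: field_simps)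
  next
    case False
    then have "0 < max k l - min k l" "0 < k + l" by auto
    with False show ?thesis
      using sum_cos_cheb_angle[of "k + l" N] sum_cos_cheb_angle[of "max k l - min k l" N] assms
      unfolding discrete_coeff_def eq by auto
  qed
qed

text \<open>Sampling at N + 1 nodes is exact on cosine polynomials of degree at most N. Aliasing
  errors therefore arise only from the part of a function beyond its partial sum.\<close>

lemma discrete_coeff_partial_sum:
  assumes "k \<le> N"
  shows "discrete_coeff N (\<lambda>j. cos_partial_sum N c (cheb_angle N j)) k = c k"
proof -
  have "discrete_coeff N (\<lambda>j. cos_partial_sum N c (cheb_angle N j)) k =
      c 0 / 2 * discrete_coeff N (\<lambda>j. cos (real 0 * cheb_angle N j)) k +
      (\<Sum>l=1..N. c l * discrete_coeff N (\<lambda>j. cos (real l * cheb_angle N j)) k)"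
  proof -
    have "(\<Sum>j=0..N. (\<Sum>l=1..N. c l * cos (real l * cheb_angle N j)) * cos (real k * cheb_angle N j)) =
      (\<Sum>l=1..N. c l * (\<Sum>j=0..N. cos (real l * cheb_angle N j) * cos (real k * cheb_angle N j)))"
      unfolding sum_distrib_right sum_distrib_left
      by (subst sum.swap) (simp add: mult.assoc)
    moreover define d where "d = 2 / (real N + 1)"
    ultimately show ?thesis
      unfolding discrete_coeff_def cos_partial_sum_def d_def[symmetric]
      by (simp add: distrib_right sum.distrib distrib_left sum_distrib_left mult_ac add_divide_distrib)
  qed
  also have "discrete_coeff N (\<lambda>j. cos (real 0 * cheb_angle N j)) k = (if k = 0 then 2 else 0)"
    using discrete_orthogonality[of k N 0] assms by simp
  also have "(\<Sum>l=1..N. c l * discrete_coeff N (\<lambda>j. cos (real l * cheb_angle N j)) k) =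
      (\<Sum>l=1..N. if k = l then c l else 0)"
    using assms by (intro sum.cong) (auto simp: discrete_orthogonality)
  also have "c 0 / 2 * (if k = 0 then 2 else 0) + (\<Sum>l=1..N. if k = l then c l else 0) = c k"
    using assms by (cases "k = 0") (auto simp: sum.delta)
  finally show ?thesis .
qed

lemma discrete_coeff_diff:
  "discrete_coeff N (\<lambda>j. y j - y' j) k = discrete_coeff N y k - discrete_coeff N y' k"
  by (simp add: discrete_coeff_def left_diff_distrib sum_subtractf right_diff_distrib)

lemma abs_discrete_coeff_le:
  assumes "\<And>j. \<bar>y j\<bar> \<le> E"
  shows "\<bar>discrete_coeff N y k\<bar> \<le> 2 * E"
proof -
  have E: "0 \<le> E" using assms[of 0] by linarith
  have "\<bar>\<Sum>j=0..N. y j * cos (real k * cheb_angle N j)\<bar> \<le> (\<Sum>j=0..N. E * 1)"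
    by (rule order_trans[OF sum_abs], intro sum_mono)
       (simp only: abs_mult, intro mult_mono assms E abs_cos_le_one abs_ge_zero)
  then have "2 / (real N + 1) * \<bar>\<Sum>j=0..N. y j * cos (real k * cheb_angle N j)\<bar>
        \<le> 2 / (real N + 1) * ((real N + 1) * E)"
    by (intro mult_left_mono) (auto simp: algebra_simps)
  then show ?thesis
    by (simp add: discrete_coeff_def abs_mult)
qed

section \<open>Cosine coefficients of functions on [0, pi]\<close>

definition cosine_coeff :: "(real \<Rightarrow> real) \<Rightarrow> nat \<Rightarrow> real" where
  "cosine_coeff u k = 2 / pi * integral {0..pi} (\<lambda>\<theta>. u \<theta> * cos (real k * \<theta>))"

lemma has_integral_cos:
  "((\<lambda>\<theta>. cos (real m * \<theta>)) has_integral (if m = 0 then pi else 0)) {0..pi}"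
proof (cases "m = 0")
  case True
  then show ?thesis using has_integral_const_real[of "1::real" 0 pi] by simp
next
  case False
  have "((\<lambda>\<theta>. cos (real m * \<theta>)) has_integral (sin (real m * pi) / real m - sin (real m * 0) / real m)) {0..pi}"
    using False by (intro fundamental_theorem_of_calculus)
      (auto intro!: derivative_eq_intros simp flip: has_real_derivative_iff_has_vector_derivative)
  then show ?thesis using False by simp
qed

lemma cos_orthogonality:
  "((\<lambda>\<theta>. cos (real l * \<theta>) * cos (real k * \<theta>)) has_integral
     pi / 2 * (if k = l then if k = 0 then 2 else 1 else 0)) {0..pi}"
proof -
  have "((\<lambda>\<theta>. cos (real (k + l) * \<theta>) / 2 + cos (real (max k l - min k l) * \<theta>) / 2) has_integral
      (if k + l = 0 then pi else 0) / 2 + (if max k l - min k l = 0 then pi else 0) / 2) {0..pi}"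
    by (intro has_integral_add has_integral_divide has_integral_cos)
  then show ?thesis
    unfolding cos_times_cos_multiples by (rule has_integral_eq_rhs) auto
qed

lemma cosine_coeff_partial_sum:
  assumes "k \<le> N"
  shows "cosine_coeff (cos_partial_sum N c) k = c k"
proof -
  define d :: "nat \<Rightarrow> real" where "d l = (if k = l then if k = 0 then 2 else 1 else 0)" for l
  have "((\<lambda>\<theta>. c 0 / 2 * (cos (real 0 * \<theta>) * cos (real k * \<theta>)) +
          (\<Sum>l=1..N. c l * (cos (real l * \<theta>) * cos (real k * \<theta>)))) has_integral
        c 0 / 2 * (pi / 2 * d 0) + (\<Sum>l=1..N. c l * (pi / 2 * d l))) {0..pi}"
    unfolding d_def
    by (intro has_integral_add has_integral_sum has_integral_mult_right cos_orthogonality) auto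
  also have "(\<lambda>\<theta>. c 0 / 2 * (cos (real 0 * \<theta>) * cos (real k * \<theta>)) +
          (\<Sum>l=1..N. c l * (cos (real l * \<theta>) * cos (real k * \<theta>)))) =
      (\<lambda>\<theta>. cos_partial_sum N c \<theta> * cos (real k * \<theta>))"
    by (simp add: cos_partial_sum_def distrib_right sum_distrib_right mult.assoc fun_eq_iff)
  finally have "cosine_coeff (cos_partial_sum N c) k =
      2 / pi * (c 0 / 2 * (pi / 2 * d 0) + (\<Sum>l=1..N. c l * (pi / 2 * d l)))"
    by (simp add: cosine_coeff_def integral_unique)
  also have "\<dots> = c 0 / 2 * d 0 + (\<Sum>l=1..N. c l * d l)"
    by (simp add: distrib_left sum_distrib_left)
  also have "(\<Sum>l=1..N. c l * d l) = (\<Sum>l=1..N. if k = l then (if k = 0 then 2 else 1) * c l else 0)"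
    by (intro sum.cong) (auto simp: d_def)
  also have "c 0 / 2 * d 0 + \<dots> = c k"
    using assms by (cases "k = 0") (auto simp: d_def sum.delta)
  finally show ?thesis .
qed

lemma continuous_on_cos_partial_sum [continuous_intros]: "continuous_on S (cos_partial_sum N c)"
  unfolding cos_partial_sum_def[abs_def] by (intro continuous_intros)

lemma abs_cosine_coeff_le:
  assumes "continuous_on {0..pi} u" "\<And>\<theta>. \<theta> \<in> {0..pi} \<Longrightarrow> \<bar>u \<theta>\<bar> \<le> E"
  shows "\<bar>cosine_coeff u k\<bar> \<le> 2 * E"
proof -
  have E: "0 \<le> E" using assms(2)[of 0] by fastforce
  have "norm (integral {0..pi} (\<lambda>\<theta>. u \<theta> * cos (real k * \<theta>))) \<le> E * (pi - 0)"
  proof (rule integral_bound)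
    show "continuous_on {0..pi} (\<lambda>\<theta>. u \<theta> * cos (real k * \<theta>))"
      by (intro continuous_intros assms)
    fix t assume "t \<in> {0..pi}"
    then have "\<bar>u t\<bar> * \<bar>cos (real k * t)\<bar> \<le> E * 1"
      by (intro mult_mono assms E abs_cos_le_one) auto
    then show "norm (u t * cos (real k * t)) \<le> E" by (simp add: abs_mult)
  qed auto
  then have "2 / pi * \<bar>integral {0..pi} (\<lambda>\<theta>. u \<theta> * cos (real k * \<theta>))\<bar> \<le> 2 / pi * (E * pi)"
    by (intro mult_left_mono) auto
  then show ?thesis by (simp add: cosine_coeff_def abs_mult)
qed

lemma cosine_coeff_lincomb:
  assumes "continuous_on {0..pi} u" "continuous_on {0..pi} v"
  shows "cosine_coeff (\<lambda>\<theta>. x * u \<theta> + y * v \<theta>) k = x * cosine_coeff u k + y * cosine_coeff v k"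
proof -
  have "integral {0..pi} (\<lambda>\<theta>. x * (u \<theta> * cos (real k * \<theta>)) + y * (v \<theta> * cos (real k * \<theta>))) =
      x * integral {0..pi} (\<lambda>\<theta>. u \<theta> * cos (real k * \<theta>)) + y * integral {0..pi} (\<lambda>\<theta>. v \<theta> * cos (real k * \<theta>))"
    by (subst Henstock_Kurzweil_Integration.integral_add)
       (auto intro!: integrable_continuous_interval continuous_intros assms)
  then show ?thesis
    by (simp add: cosine_coeff_def algebra_simps)
qed

text \<open>For N at least k, the k-th coefficient of the partial sum is already \<open>c k\<close>,
  so the difference is the k-th coefficient of a function bounded by \<open>e N\<close>, hence at
  most \<open>2 * e N\<close>.\<close>

lemma cosine_coeff_eqI:
  assumes cont: "continuous_on {0..pi} u"
    and approx: "\<And>N \<theta>. \<theta> \<in> {0..pi} \<Longrightarrow> \<bar>u \<theta> - cos_partial_sum N c \<theta>\<bar> \<le> e N"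
    and e: "e \<longlonglongrightarrow> 0"
  shows "cosine_coeff u k = c k"
proof -
  have "\<bar>cosine_coeff u k - c k\<bar> \<le> 2 * e N" if "N \<ge> k" for N
  proof -
    have "cosine_coeff (\<lambda>\<theta>. 1 * u \<theta> + (-1) * cos_partial_sum N c \<theta>) k = cosine_coeff u k - c k"
      by (subst cosine_coeff_lincomb) (auto intro!: cont continuous_intros simp: cosine_coeff_partial_sum that)
    moreover have "\<bar>cosine_coeff (\<lambda>\<theta>. 1 * u \<theta> + (-1) * cos_partial_sum N c \<theta>) k\<bar> \<le> 2 * e N"
      by (rule abs_cosine_coeff_le) (use approx in \<open>auto intro!: continuous_intros cont\<close>)
    ultimately show ?thesis by simp
  qed
  moreover have "(\<lambda>N. 2 * e N) \<longlonglongrightarrow> 2 * 0"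
    by (intro tendsto_intros e)
  ultimately have "\<bar>cosine_coeff u k - c k\<bar> \<le> 2 * 0"
    by (intro LIMSEQ_le_const[where X = "\<lambda>N. 2 * e N"]) auto
  then show ?thesis by simp
qed

section \<open>Chebyshev coefficients of the monomials z^j\<close>

primrec monom_coeff :: "nat \<Rightarrow> nat \<Rightarrow> real" where
  "monom_coeff 0 = (\<lambda>k. if k = 0 then 2 else 0)"
| "monom_coeff (Suc j) = (\<lambda>k. monom_coeff j k / 4 +
      (if k = 0 then monom_coeff j 1 / 4 else (monom_coeff j (k - 1) + monom_coeff j (Suc k)) / 8))"

definition cheb_point :: "real \<Rightarrow> real" where
  "cheb_point \<theta> = (1 + cos \<theta>) / 4"

text \<open>The right vertex of the ellipse with parameter \<open>r\<close>, in the variable \<open>z = (1 + t)/4\<close>.\<close>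

definition ellipse_vertex :: "real \<Rightarrow> real" where
  "ellipse_vertex r = 1 / 4 + (r + 1 / r) / 8"

lemma monom_coeff_nonneg: "0 \<le> monom_coeff j k"
  by (induction j arbitrary: k) auto

lemma monom_coeff_eq_0: "j < k \<Longrightarrow> monom_coeff j k = 0"
  by (induction j arbitrary: k) auto

text \<open>At the vertex q the k-th Chebyshev polynomial in 4z - 1 equals (r^k + r^(-k))/2. As all
  coefficients of z^j are nonnegative, each term of its expansion at q is at most q^j. The induction
  encodes this: for k > 0, the recursion maps the sequence r^(-k) to exactly q r^(-k); at k = 0 it
  gives at most q, because 1/r is at most r.\<close>

lemma monom_coeff_le:
  assumes "r \<ge> 1"
  shows "monom_coeff j k \<le> 2 * ellipse_vertex r ^ j / r ^ k"
proof (induction j arbitrary: k)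
  case 0
  then show ?case using assms by auto
next
  case (Suc j)
  define q where "q = ellipse_vertex r"
  have q: "q \<ge> 0" using assms by (simp add: q_def ellipse_vertex_def)
  show ?case
  proof (cases "k = 0")
    case True
    have "monom_coeff j 0 / 4 + monom_coeff j 1 / 4 \<le> 2 * q ^ j * (1 / 4 + 1 / (4 * r))"
      using Suc[of 0] Suc[of 1] unfolding q_def[symmetric] by (simp add: distrib_left)
    also have "\<dots> \<le> 2 * q ^ j * q"
    proof (intro mult_left_mono)
      have "1 / r \<le> r" using assms
        by (metis div_by_1 frac_le order_trans zero_le_one zero_less_one)
      then show "1 / 4 + 1 / (4 * r) \<le> q" 
        by (simp add: q_def ellipse_vertex_def)
    qed (use q in auto)
    finally show ?thesis using True by (simp add: q_def mult_ac)
  next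
    case False
    then obtain l where l: "k = Suc l" by (cases k) auto
    have "monom_coeff (Suc j) k \<le> 2 * q ^ j / r ^ k / 4 + (2 * q ^ j / r ^ l + 2 * q ^ j / r ^ Suc k) / 8"
    proof -
      have "monom_coeff (Suc j) k = monom_coeff j k / 4 + (monom_coeff j l + monom_coeff j (Suc k)) / 8"
        using l by simp
      then show ?thesis
        using Suc[of k] Suc[of l] Suc[of "Suc k"] unfolding q_def
        by (simp only:) (intro add_mono divide_right_mono, auto)
    qed
    also have "\<dots> = 2 * q ^ j / r ^ k * q"
      using assms l by (simp add: q_def ellipse_vertex_def field_simps)
    finally show ?thesis by (simp add: q_def mult_ac)
  qed
qed

lemma cos_recurrence:
  "cheb_point \<theta> * cos (real (Suc k) * \<theta>) =
     cos (real (Suc k) * \<theta>) / 4 + (cos (real k * \<theta>) + cos (real (Suc (Suc k)) * \<theta>)) / 8"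
proof -
  have "cos (real k * \<theta>) = cos (real (Suc k) * \<theta> - \<theta>)"
    "cos (real (Suc (Suc k)) * \<theta>) = cos (real (Suc k) * \<theta> + \<theta>)"
    by (simp_all add: algebra_simps)
  then show ?thesis
    unfolding cos_add cos_diff by (simp add: cheb_point_def field_simps)
qed

text \<open>The recursion for \<open>monom_coeff\<close> is multiplication by z = (1 + cos
  \<open>\<theta>\<close>)/4 in the cosine basis. Index 0 has its own case, and the constant 1 has
  coefficient 2, because the coefficient with index 0 is counted by half.\<close>

lemma cheb_point_power:
  assumes "j \<le> N"
  shows "cheb_point \<theta> ^ j = cos_partial_sum N (monom_coeff j) \<theta>"
  using assms
proof (induction j arbitrary: N)
  case 0
  have "(\<Sum>k=1..N. (if k = 0 then 2 else 0) * cos (real k * \<theta>)) = 0"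
    by (intro sum.neutral) auto
  then show ?case by (simp add: cos_partial_sum_def)
next
  case (Suc j)
  then obtain M where M: "N = Suc M" "j \<le> M" by (cases N) auto
  define c where "c = monom_coeff j"
  define C where "C k = cos (real k * \<theta>)" for k
  have c0: "c (Suc M) = 0" "c (Suc (Suc M)) = 0"
    using M by (auto simp: c_def intro!: monom_coeff_eq_0)
  have C0: "C 0 = 1" by (simp add: C_def)
  have step: "cheb_point \<theta> * C (Suc k) = C (Suc k) / 4 + (C k + C (Suc (Suc k))) / 8" for k
    unfolding C_def by (rule cos_recurrence)
  have C1: "cheb_point \<theta> = 1 / 4 + C 1 / 4" by (simp add: cheb_point_def C_def)
  \<comment> \<open>Multiplying a truncated sum by z leaves two boundary terms. They vanish at K =
    N, since the coefficients of z^j with indices N and N + 1 are zero for j < N.\<close>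
  have key: "cheb_point \<theta> * (\<Sum>k=1..K. c k * C k) + cheb_point \<theta> * c 0 / 2 =
      c 0 / 8 + c 1 / 8 + (\<Sum>k=1..K. (c k / 4 + (c (k - 1) + c (Suc k)) / 8) * C k)
      + c K * C (Suc K) / 8 - c (Suc K) * C K / 8" for K
  proof (induction K)
    case 0
    then show ?case by (simp add: C1 C0 field_simps)
  next
    case (Suc K)
    have "cheb_point \<theta> * (\<Sum>k=1..Suc K. c k * C k) + cheb_point \<theta> * c 0 / 2 =
       (cheb_point \<theta> * (\<Sum>k=1..K. c k * C k) + cheb_point \<theta> * c 0 / 2) + c (Suc K) * (cheb_point \<theta> * C (Suc K))"
      by (simp add: algebra_simps)
    then show ?case unfolding Suc step
      by (simp add: algebra_simps add_divide_distrib)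
  qed
  have "cheb_point \<theta> ^ Suc j = cheb_point \<theta> * cos_partial_sum N c \<theta>"
    using Suc.IH[of N] Suc.prems by (simp add: c_def)
  also have "\<dots> = cheb_point \<theta> * (\<Sum>k=1..N. c k * C k) + cheb_point \<theta> * c 0 / 2"
    by (simp add: cos_partial_sum_def C_def algebra_simps)
  also have "\<dots> = c 0 / 8 + c 1 / 8 + (\<Sum>k=1..N. (c k / 4 + (c (k - 1) + c (Suc k)) / 8) * C k)"
    unfolding key using c0 M by simp
  also have "(\<Sum>k=1..N. (c k / 4 + (c (k - 1) + c (Suc k)) / 8) * C k) =
      (\<Sum>k=1..N. monom_coeff (Suc j) k * C k)"
    by (intro sum.cong) (auto simp: c_def)
  finally show ?case
    by (simp add: cos_partial_sum_def c_def C_def)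
qed

text \<open>The two estimates have separate uses: coefficient decay controls the values discarded at
  the start of the downward recursion, and the uniform truncation error controls the samples at the
  nodes and the aliasing.\<close>

definition geometric_cos_series :: "real \<Rightarrow> (real \<Rightarrow> real) \<Rightarrow> bool" where
  "geometric_cos_series r u \<longleftrightarrow>
     (\<exists>K. \<forall>k. \<bar>cosine_coeff u k\<bar> \<le> K / r ^ k \<and>
           (\<forall>\<theta>. \<bar>u \<theta> - cos_partial_sum k (cosine_coeff u) \<theta>\<bar> \<le> K / r ^ k))"

lemma sum_geometric_tail_le:
  fixes r :: real
  assumes "r > 1"
  shows "(\<Sum>k\<in>{N<..N + d}. 1 / r ^ k) \<le> 1 / (r - 1) / r ^ N"
proof -
  have "(\<Sum>k\<in>{N<..N + d}. 1 / r ^ k) = (1 / r ^ N - 1 / r ^ (N + d)) / (r - 1)"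
  proof (induction d)
    case (Suc d)
    have "{N<..N + Suc d} = insert (N + Suc d) {N<..N + d}" by auto
    then have "(\<Sum>k\<in>{N<..N + Suc d}. 1 / r ^ k) = 1 / r ^ Suc (N + d) + (\<Sum>k\<in>{N<..N + d}. 1 / r ^ k)"
      by simp
    also have "1 / r ^ Suc (N + d) = (1 / r ^ (N + d) - 1 / r ^ Suc (N + d)) / (r - 1)"
      using assms by (simp add: field_simps)
    finally show ?case unfolding Suc by (simp flip: add_divide_distrib)
  qed simp
  also have "\<dots> \<le> (1 / r ^ N) / (r - 1)"
    using assms by (intro divide_right_mono) auto
  finally show ?thesis by (simp add: mult.commute)
qed

text \<open>The bound is a product of r^(-N) and q^j, so it can be summed against Taylor
  coefficients for fixed N. The error is zero for j up to N and otherwise a finite tail, dominated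
  by a geometric one.\<close>

lemma cheb_point_power_approx:
  assumes "r > 1"
  shows "\<bar>cheb_point \<theta> ^ j - cos_partial_sum N (monom_coeff j) \<theta>\<bar>
           \<le> 2 / (r - 1) / r ^ N * ellipse_vertex r ^ j"
proof (cases "j \<le> N")
  case True
  then show ?thesis using cheb_point_power[OF True] assms by (simp add: ellipse_vertex_def)
next
  case False
  define d where "d = j - N"
  have j: "j = N + d" using False by (simp add: d_def)
  have "{1..N + d} = {1..N} \<union> {N<..N + d}" by auto
  then have "(\<Sum>k=1..N + d. monom_coeff j k * cos (real k * \<theta>)) =
      (\<Sum>k=1..N. monom_coeff j k * cos (real k * \<theta>)) +
      (\<Sum>k\<in>{N<..N + d}. monom_coeff j k * cos (real k * \<theta>))"
    by (subst sum.union_disjoint[symmetric]) (auto simp: ivl_disj_un)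
  then have "cheb_point \<theta> ^ j - cos_partial_sum N (monom_coeff j) \<theta> =
      (\<Sum>k\<in>{N<..N + d}. monom_coeff j k * cos (real k * \<theta>))"
    using cheb_point_power[of j "N + d" \<theta>] j by (simp add: cos_partial_sum_def)
  also have "\<bar>\<dots>\<bar> \<le> (\<Sum>k\<in>{N<..N + d}. \<bar>monom_coeff j k * cos (real k * \<theta>)\<bar>)"
    by (rule sum_abs)
  also have "\<dots> \<le> (\<Sum>k\<in>{N<..N + d}. 2 * ellipse_vertex r ^ j * (1 / r ^ k))"
  proof (rule sum_mono)
    fix k
    have "\<bar>monom_coeff j k * cos (real k * \<theta>)\<bar> \<le> monom_coeff j k * 1"
      unfolding abs_mult by (intro mult_mono) (auto simp: monom_coeff_nonneg)
    also have "\<dots> \<le> 2 * ellipse_vertex r ^ j / r ^ k"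
      using monom_coeff_le[of r j k] assms by simp
    finally show "\<bar>monom_coeff j k * cos (real k * \<theta>)\<bar> \<le> 2 * ellipse_vertex r ^ j * (1 / r ^ k)"
      by simp
  qed
  also have "\<dots> = 2 * ellipse_vertex r ^ j * (\<Sum>k\<in>{N<..N + d}. 1 / r ^ k)"
    by (simp add: sum_distrib_left)
  also have "\<dots> \<le> 2 * ellipse_vertex r ^ j * (1 / (r - 1) / r ^ N)"
    using assms by (intro mult_left_mono sum_geometric_tail_le) (auto simp: ellipse_vertex_def)
  finally show ?thesis by (simp add: mult_ac)
qed

lemma abs_sums_le:
  fixes f g :: "nat \<Rightarrow> real"
  assumes "f sums s" "g sums t" "\<And>j. \<bar>f j\<bar> \<le> g j"
  shows "\<bar>s\<bar> \<le> t"
  using norm_sums_le[OF assms(1,2)] assms(3) by simp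

text \<open>Summing the expansions of the monomials gives candidate coefficients \<open>c k\<close>.
  The partial sums in k are finite, so they commute with the series in j, and no double series has
  to be rearranged. The resulting uniform estimate then identifies \<open>c k\<close> with the
  integral coefficients.\<close>

lemma geometric_cos_series_powser:
  assumes r: "r > 1" and cont: "continuous_on {0..pi} u"
    and summable: "summable (\<lambda>j. \<bar>p j\<bar> * ellipse_vertex r ^ j)"
    and u: "\<And>\<theta>. (\<lambda>j. p j * cheb_point \<theta> ^ j) sums u \<theta>"
  shows "geometric_cos_series r u"
proof -
  define q where "q = ellipse_vertex r"
  define S where "S = (\<Sum>j. \<bar>p j\<bar> * q ^ j)"
  define c where "c k = (\<Sum>j. p j * monom_coeff j k)" for k
  have S: "(\<lambda>j. \<bar>p j\<bar> * q ^ j) sums S"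
    using summable unfolding S_def q_def by (rule summable_sums)
  have le: "\<bar>p j * monom_coeff j k\<bar> \<le> 2 / r ^ k * (\<bar>p j\<bar> * q ^ j)" for j k
  proof -
    have "\<bar>p j * monom_coeff j k\<bar> = \<bar>p j\<bar> * monom_coeff j k"
      by (simp add: abs_mult monom_coeff_nonneg)
    also have "\<dots> \<le> \<bar>p j\<bar> * (2 * q ^ j / r ^ k)"
      unfolding q_def using r by (intro mult_left_mono monom_coeff_le) auto
    finally show ?thesis by (simp add: mult_ac)
  qed
  have c: "(\<lambda>j. p j * monom_coeff j k) sums c k" for k
    unfolding c_def
    by (intro summable_sums summable_comparison_test'[OF sums_summable[OF sums_mult[OF S]], where N = 0])
       (simp only: real_norm_def, rule le)
  have c_le: "\<bar>c k\<bar> \<le> 2 / r ^ k * S" for k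
    by (rule abs_sums_le[OF c sums_mult[OF S] le])
  have approx: "\<bar>u \<theta> - cos_partial_sum N c \<theta>\<bar> \<le> 2 / (r - 1) / r ^ N * S" for N \<theta>
  proof (rule abs_sums_le)
    have "(\<lambda>j. p j * monom_coeff j 0 * (1 / 2) + (\<Sum>k=1..N. p j * monom_coeff j k * cos (real k * \<theta>)))
        sums (c 0 * (1 / 2) + (\<Sum>k=1..N. c k * cos (real k * \<theta>)))"
      by (intro sums_add sums_sum sums_mult2 c)
    then have "(\<lambda>j. p j * cos_partial_sum N (monom_coeff j) \<theta>) sums cos_partial_sum N c \<theta>"
      by (simp add: cos_partial_sum_def algebra_simps sum_distrib_left)
    from sums_diff[OF u this]
    show "(\<lambda>j. p j * (cheb_point \<theta> ^ j - cos_partial_sum N (monom_coeff j) \<theta>))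
            sums (u \<theta> - cos_partial_sum N c \<theta>)"
      by (simp add: right_diff_distrib)
    show "(\<lambda>j. 2 / (r - 1) / r ^ N * (\<bar>p j\<bar> * q ^ j)) sums (2 / (r - 1) / r ^ N * S)"
      by (intro sums_mult S)
    fix j
    have "\<bar>p j\<bar> * \<bar>cheb_point \<theta> ^ j - cos_partial_sum N (monom_coeff j) \<theta>\<bar>
        \<le> \<bar>p j\<bar> * (2 / (r - 1) / r ^ N * q ^ j)"
      unfolding q_def by (intro mult_left_mono cheb_point_power_approx r) auto
    then show "\<bar>p j * (cheb_point \<theta> ^ j - cos_partial_sum N (monom_coeff j) \<theta>)\<bar>
        \<le> 2 / (r - 1) / r ^ N * (\<bar>p j\<bar> * q ^ j)"
      by (simp add: abs_mult mult_ac)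
  qed
  have "(\<lambda>N. 2 / (r - 1) / r ^ N * S) \<longlonglongrightarrow> 0"
  proof -
    have "(\<lambda>N. 2 / (r - 1) * S * (1 / r) ^ N) \<longlonglongrightarrow> 2 / (r - 1) * S * 0"
      by (intro tendsto_intros LIMSEQ_power_zero) (use r in auto)
    then show ?thesis by (simp add: field_simps)
  qed
  from cosine_coeff_eqI[OF cont approx this] have eq: "cosine_coeff u = c" by (simp add: fun_eq_iff)
  have S0: "0 \<le> S"
    by (rule sums_le[OF _ sums_zero S]) (use r in \<open>auto simp: q_def ellipse_vertex_def\<close>)
  \<comment> \<open>One constant dominating both the factor 2 of the coefficient bound and the
    factor 2/(r - 1) of the truncation bound.\<close>
  have r': "2 \<le> 2 + 2 / (r - 1)" "2 / (r - 1) \<le> 2 + 2 / (r - 1)" using r by auto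
  have "\<bar>c k\<bar> \<le> (2 + 2 / (r - 1)) * S / r ^ k" for k
    using order_trans[OF c_le[of k]] mult_right_mono[OF r'(1), of "S / r ^ k"] S0 r by simp
  moreover have "\<bar>u \<theta> - cos_partial_sum k c \<theta>\<bar> \<le> (2 + 2 / (r - 1)) * S / r ^ k" for k \<theta>
    using order_trans[OF approx[of \<theta> k]] mult_right_mono[OF r'(2), of "S / r ^ k"] S0 r by simp
  ultimately show ?thesis
    unfolding geometric_cos_series_def eq by blast
qed

lemma cheb_point_bounds: "0 \<le> cheb_point \<theta>" "cheb_point \<theta> \<le> 1 / 2"
proof -
  have gen: "0 \<le> (1 + c) / 4" if "- 1 \<le> c" for c :: real
    using that by simp
  show "0 \<le> cheb_point \<theta>" unfolding cheb_point_def by (rule gen) (rule cos_ge_minus_one)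
  show "cheb_point \<theta> \<le> 1 / 2" by (simp add: cheb_point_def)
qed

lemma continuous_on_cheb_point [continuous_intros]: "continuous_on S cheb_point"
  unfolding cheb_point_def[abs_def] by (intro continuous_intros) auto

text \<open>The confocal ellipse through \<open>1\<close> lies in the unit disc around its focus \<open>0\<close>, so the Taylor
  series at \<open>0\<close> suffices to obtain the optimal rate of decay of the Chebyshev coefficients.\<close>

lemma geometric_cos_series_holomorphic:
  assumes hol: "f holomorphic_on ball 0 1" and r: "r > 1" "ellipse_vertex r < 1"
  shows "geometric_cos_series r (\<lambda>\<theta>. Re (f (complex_of_real (cheb_point \<theta>))))"
proof -
  define a where "a j = (deriv ^^ j) f 0 / fact j" for j
  define q where "q = ellipse_vertex r"
  have q: "0 < q" "q < 1" using r by (auto simp: q_def ellipse_vertex_def add_pos_pos)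
  have sums: "(\<lambda>j. a j * w ^ j) sums f w" if "w \<in> ball 0 1" for w
    using holomorphic_power_series[OF hol that] by (simp add: a_def)
  show ?thesis
  proof (rule geometric_cos_series_powser[OF r(1)])
    show "continuous_on {0..pi} (\<lambda>\<theta>. Re (f (complex_of_real (cheb_point \<theta>))))"
    proof (intro continuous_on_Re continuous_on_compose2[OF holomorphic_on_imp_continuous_on[OF hol]]
        continuous_intros)
      show "(\<lambda>\<theta>. complex_of_real (cheb_point \<theta>)) ` {0..pi} \<subseteq> ball 0 1"
        using cheb_point_bounds by (force intro: le_less_trans[of _ "1/2"])
    qed
    \<comment> \<open>Convergence at the larger point (1 + q)/2, still inside the unit disc, yields
      absolute convergence at q.\<close>
    have "summable (\<lambda>j. norm (a j * (complex_of_real q) ^ j))"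
    proof (rule powser_insidea)
      show "summable (\<lambda>j. a j * complex_of_real ((1 + q) / 2) ^ j)"
        using q by (intro sums_summable[OF sums]) (auto simp del: of_real_add of_real_divide)
      show "norm (complex_of_real q) < norm (complex_of_real ((1 + q) / 2))"
        unfolding norm_of_real using q by simp
    qed
    then show "summable (\<lambda>j. \<bar>Re (a j)\<bar> * ellipse_vertex r ^ j)"
    proof (rule summable_comparison_test'[where N = 0])
      fix j
      show "norm (\<bar>Re (a j)\<bar> * ellipse_vertex r ^ j) \<le> norm (a j * complex_of_real q ^ j)"
        using q by (auto simp: norm_mult norm_power abs_mult q_def[symmetric]
            intro!: mult_right_mono abs_Re_le_cmod)
    qed
    fix \<theta>
    have "norm (complex_of_real (cheb_point \<theta>)) < 1"
      unfolding norm_of_real using cheb_point_bounds[of \<theta>] by simp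
    then have "(\<lambda>j. a j * complex_of_real (cheb_point \<theta>) ^ j) sums f (complex_of_real (cheb_point \<theta>))"
      by (intro sums) simp
    from sums_Re[OF this]
    show "(\<lambda>j. Re (a j) * cheb_point \<theta> ^ j) sums Re (f (complex_of_real (cheb_point \<theta>)))"
      by (simp flip: of_real_power)
  qed
qed

section \<open>The Euler equation on the level of coefficients\<close>

lemma has_integral_cosine_coeff:
  assumes "continuous_on {0..pi} u"
  shows "((\<lambda>\<theta>. u \<theta> * cos (real k * \<theta>)) has_integral pi / 2 * cosine_coeff u k) {0..pi}"
  unfolding cosine_coeff_def
  using integrable_integral[OF integrable_continuous_interval, of 0 pi "\<lambda>\<theta>. u \<theta> * cos (real k * \<theta>)"]
  by (simp add: continuous_intros assms)

text \<open>With w the derivative of a function in the variable z, this expresses the term z f' of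
  the Euler equation through the coefficients of f'.\<close>

lemma cosine_coeff_cheb_point_mult:
  assumes "continuous_on {0..pi} w"
  shows "cosine_coeff (\<lambda>\<theta>. cheb_point \<theta> * w \<theta>) 0 = (cosine_coeff w 0 + cosine_coeff w 1) / 4"
    and "cosine_coeff (\<lambda>\<theta>. cheb_point \<theta> * w \<theta>) (Suc k) =
           cosine_coeff w (Suc k) / 4 + (cosine_coeff w k + cosine_coeff w (Suc (Suc k))) / 8"
proof -
  note int = has_integral_cosine_coeff[OF assms]
  have "((\<lambda>\<theta>. w \<theta> * cos (real 0 * \<theta>) / 4 + w \<theta> * cos (real 1 * \<theta>) / 4) has_integral
      pi / 2 * cosine_coeff w 0 / 4 + pi / 2 * cosine_coeff w 1 / 4) {0..pi}"
    by (intro has_integral_add has_integral_divide int)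
  also have "(\<lambda>\<theta>. w \<theta> * cos (real 0 * \<theta>) / 4 + w \<theta> * cos (real 1 * \<theta>) / 4) =
      (\<lambda>\<theta>. cheb_point \<theta> * w \<theta> * cos (real 0 * \<theta>))"
    by (simp add: cheb_point_def fun_eq_iff field_simps)
  finally show "cosine_coeff (\<lambda>\<theta>. cheb_point \<theta> * w \<theta>) 0 = (cosine_coeff w 0 + cosine_coeff w 1) / 4"
    unfolding cosine_coeff_def[of "\<lambda>\<theta>. cheb_point \<theta> * w \<theta>"]
    by (simp add: integral_unique field_simps)
  have "((\<lambda>\<theta>. w \<theta> * cos (real (Suc k) * \<theta>) / 4 +
        (w \<theta> * cos (real k * \<theta>) + w \<theta> * cos (real (Suc (Suc k)) * \<theta>)) / 8) has_integral
      pi / 2 * cosine_coeff w (Suc k) / 4 +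
        (pi / 2 * cosine_coeff w k + pi / 2 * cosine_coeff w (Suc (Suc k))) / 8) {0..pi}"
    by (intro has_integral_add has_integral_divide int)
  also have "(\<lambda>\<theta>. w \<theta> * cos (real (Suc k) * \<theta>) / 4 +
        (w \<theta> * cos (real k * \<theta>) + w \<theta> * cos (real (Suc (Suc k)) * \<theta>)) / 8) =
      (\<lambda>\<theta>. cheb_point \<theta> * w \<theta> * cos (real (Suc k) * \<theta>))"
  proof
    fix \<theta>
    show "w \<theta> * cos (real (Suc k) * \<theta>) / 4 +
        (w \<theta> * cos (real k * \<theta>) + w \<theta> * cos (real (Suc (Suc k)) * \<theta>)) / 8 =
      cheb_point \<theta> * w \<theta> * cos (real (Suc k) * \<theta>)"
      using arg_cong[OF cos_recurrence[of \<theta> k], of "(*) (w \<theta>)"]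
      by (simp only: distrib_left mult_ac times_divide_eq_right)
  qed
  finally show "cosine_coeff (\<lambda>\<theta>. cheb_point \<theta> * w \<theta>) (Suc k) =
           cosine_coeff w (Suc k) / 4 + (cosine_coeff w k + cosine_coeff w (Suc (Suc k))) / 8"
    unfolding cosine_coeff_def[of "\<lambda>\<theta>. cheb_point \<theta> * w \<theta>"]
    by (simp only: integral_unique) (simp add: field_simps)
qed

text \<open>Integrate the derivative of u(\<open>\<theta>\<close>) sin((k+1)
  \<open>\<theta>\<close>) over [0, pi]: the boundary terms vanish with the sine. The 8 combines 1/4
  from the chain rule for (1 + cos \<open>\<theta>\<close>)/4 with 1/2 from the product formula for
  two sines.\<close>

lemma cosine_coeff_by_parts:
  assumes deriv: "\<And>x. 0 \<le> x \<Longrightarrow> x \<le> 1 / 2 \<Longrightarrow> (\<phi> has_real_derivative \<phi>' x) (at x)"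
    and cont: "continuous_on {0..1/2} \<phi>'"
  shows "cosine_coeff (\<lambda>\<theta>. \<phi> (cheb_point \<theta>)) (Suc k) =
    (cosine_coeff (\<lambda>\<theta>. \<phi>' (cheb_point \<theta>)) k - cosine_coeff (\<lambda>\<theta>. \<phi>' (cheb_point \<theta>)) (Suc (Suc k)))
      / (8 * real (Suc k))"
proof -
  define u where "u \<theta> = \<phi> (cheb_point \<theta>)" for \<theta>
  define w where "w \<theta> = \<phi>' (cheb_point \<theta>)" for \<theta>
  have contw: "continuous_on {0..pi} w"
    unfolding w_def by (rule continuous_on_compose2[OF cont])
      (use cheb_point_bounds in \<open>auto intro!: continuous_intros\<close>)
  have du: "(u has_real_derivative w \<theta> * (- sin \<theta> / 4)) (at \<theta>)" for \<theta>
    unfolding u_def w_def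
    by (rule DERIV_chain2[where g = cheb_point, OF deriv[OF cheb_point_bounds]])
       (auto simp: cheb_point_def[abs_def] intro!: derivative_eq_intros)
  have contu: "continuous_on {0..pi} u"
    by (rule DERIV_continuous_on[OF has_field_derivative_at_within[OF du]])
  have boundary: "((\<lambda>\<theta>. real (Suc k) * (u \<theta> * cos (real (Suc k) * \<theta>)) -
            (w \<theta> * cos (real k * \<theta>) - w \<theta> * cos (real (Suc (Suc k)) * \<theta>)) / 8) has_integral
       u pi * sin (real (Suc k) * pi) - u 0 * sin (real (Suc k) * 0)) {0..pi}"
  proof (rule fundamental_theorem_of_calculus)
    fix \<theta> assume "\<theta> \<in> {0..pi}"
    have "((\<lambda>\<theta>. u \<theta> * sin (real (Suc k) * \<theta>)) has_real_derivative
        u \<theta> * (cos (real (Suc k) * \<theta>) * real (Suc k)) + w \<theta> * (- sin \<theta> / 4) * sin (real (Suc k) * \<theta>)) (at \<theta>)"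
      by (rule DERIV_mult'[OF du]) (auto intro!: derivative_eq_intros)
    moreover have "sin \<theta> * sin (real (Suc k) * \<theta>) = (cos (real k * \<theta>) - cos (real (Suc (Suc k)) * \<theta>)) / 2"
    proof -
      have "cos (real k * \<theta>) = cos (real (Suc k) * \<theta> - \<theta>)"
        "cos (real (Suc (Suc k)) * \<theta>) = cos (real (Suc k) * \<theta> + \<theta>)"
        by (simp_all add: algebra_simps)
      then show ?thesis unfolding cos_add cos_diff by simp
    qed
    then have "u \<theta> * (cos (real (Suc k) * \<theta>) * real (Suc k)) + w \<theta> * (- sin \<theta> / 4) * sin (real (Suc k) * \<theta>)
      = real (Suc k) * (u \<theta> * cos (real (Suc k) * \<theta>)) -
            (w \<theta> * cos (real k * \<theta>) - w \<theta> * cos (real (Suc (Suc k)) * \<theta>)) / 8"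
      by (simp only: mult.assoc mult_minus_left minus_divide_left[symmetric] mult_minus_right
            times_divide_eq_left times_divide_eq_right) (simp add: algebra_simps)
    ultimately show "((\<lambda>\<theta>. u \<theta> * sin (real (Suc k) * \<theta>)) has_vector_derivative
        real (Suc k) * (u \<theta> * cos (real (Suc k) * \<theta>)) -
            (w \<theta> * cos (real k * \<theta>) - w \<theta> * cos (real (Suc (Suc k)) * \<theta>)) / 8) (at \<theta> within {0..pi})"
      by (simp only: has_real_derivative_iff_has_vector_derivative[symmetric] has_field_derivative_at_within)
  qed auto
  have coeffs: "((\<lambda>\<theta>. real (Suc k) * (u \<theta> * cos (real (Suc k) * \<theta>)) -
            (w \<theta> * cos (real k * \<theta>) - w \<theta> * cos (real (Suc (Suc k)) * \<theta>)) / 8) has_integral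
       real (Suc k) * (pi / 2 * cosine_coeff u (Suc k)) -
         (pi / 2 * cosine_coeff w k - pi / 2 * cosine_coeff w (Suc (Suc k))) / 8) {0..pi}"
    by (intro has_integral_diff has_integral_divide has_integral_mult_right
          has_integral_cosine_coeff contu contw)
  have "sin (real (Suc k) * pi) = 0" by (rule sin_npi)
  then have "real (Suc k) * (pi / 2 * cosine_coeff u (Suc k)) -
         (pi / 2 * cosine_coeff w k - pi / 2 * cosine_coeff w (Suc (Suc k))) / 8 = 0"
    using has_integral_unique[OF coeffs boundary] by (simp only:) simp
  then have "pi / 2 * (real (Suc k) * cosine_coeff u (Suc k) - (cosine_coeff w k - cosine_coeff w (Suc (Suc k))) / 8) = 0"
    by (simp only: right_diff_distrib diff_divide_distrib mult_ac times_divide_eq_right)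
  then have "real (Suc k) * cosine_coeff u (Suc k) = (cosine_coeff w k - cosine_coeff w (Suc (Suc k))) / 8"
    using pi_gt_zero by (simp only: mult_eq_0_iff) simp
  then show ?thesis unfolding u_def[symmetric] w_def[symmetric]
    by (simp add: field_simps del: of_nat_Suc)
qed

section \<open>Error propagation in the algorithm\<close>

text \<open>In terms of \<open>\<mu>\<^sub>k + \<mu>\<^sub>k\<^sub>+\<^sub>1\<close> the downward recursion has first order, with multiplier
  \<open>-(k - A)/(k + A)\<close> of modulus at most \<open>1\<close>; this makes it stable.\<close>

lemma downward_rec_error:
  assumes A: "A > 0"
    and rec: "\<And>k. 8 * \<eta> (Suc k) = 2 * \<mu> (Suc k) + \<mu> k * (1 + A / real (Suc k)) +
                \<mu> (Suc (Suc k)) * (1 - A / real (Suc k))"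
    and \<eta>: "\<And>k. k \<le> N \<Longrightarrow> \<bar>\<eta>' k - \<eta> k\<bar> \<le> \<delta>"
    and \<mu>: "\<bar>\<mu> N\<bar> \<le> \<tau>" "\<bar>\<mu> (Suc N)\<bar> \<le> \<tau>" and "k \<le> Suc N"
  shows "\<bar>downward_rec N A \<eta>' k - \<mu> k\<bar> \<le> \<tau> + real N * (2 * \<tau> + 8 * \<delta> * real N)"
proof -
  define d where "d k = downward_rec N A \<eta>' k - \<mu> k" for k
  have \<delta>: "0 \<le> \<delta>" using \<eta>[of 0] by simp
  have \<tau>: "0 \<le> \<tau>" using \<mu>(1) by linarith
  have dN: "\<bar>d N\<bar> \<le> \<tau>" "\<bar>d (Suc N)\<bar> \<le> \<tau>"
    using \<mu> by (simp_all add: d_def downward_rec.simps)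
  have step: "\<bar>d k + d (Suc k)\<bar> \<le> 8 * \<delta> + \<bar>d (Suc k) + d (Suc (Suc k))\<bar>" if k: "k < N" for k
  proof -
    define \<alpha> where "\<alpha> = A / real (Suc k)"
    have \<alpha>: "\<alpha> > 0" using A by (simp add: \<alpha>_def)
    have "(1 + \<alpha>) * downward_rec N A \<eta>' k = 8 * \<eta>' (Suc k) - 2 * downward_rec N A \<eta>' (Suc k)
            - downward_rec N A \<eta>' (Suc (Suc k)) * (1 - \<alpha>)"
      using k \<alpha> by (subst downward_rec.simps) (simp add: \<alpha>_def[symmetric] del: of_nat_Suc)
    then have "(1 + \<alpha>) * (d k + d (Suc k)) =
        8 * (\<eta>' (Suc k) - \<eta> (Suc k)) - (1 - \<alpha>) * (d (Suc k) + d (Suc (Suc k)))"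
      using rec[of k] by (simp add: d_def \<alpha>_def[symmetric] algebra_simps del: of_nat_Suc)
    then have "\<bar>(1 + \<alpha>) * (d k + d (Suc k))\<bar> \<le>
        8 * \<bar>\<eta>' (Suc k) - \<eta> (Suc k)\<bar> + \<bar>1 - \<alpha>\<bar> * \<bar>d (Suc k) + d (Suc (Suc k))\<bar>"
      using abs_triangle_ineq4[of "8 * (\<eta>' (Suc k) - \<eta> (Suc k))" "(1 - \<alpha>) * (d (Suc k) + d (Suc (Suc k)))"]
      by (simp only: abs_mult abs_numeral)
    also have "\<dots> \<le> (1 + \<alpha>) * (8 * \<delta>) + (1 + \<alpha>) * \<bar>d (Suc k) + d (Suc (Suc k))\<bar>"
    proof (intro add_mono mult_right_mono)
      have "8 * \<bar>\<eta>' (Suc k) - \<eta> (Suc k)\<bar> \<le> 1 * (8 * \<delta>)" using \<eta>[of "Suc k"] k by simp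
      also have "\<dots> \<le> (1 + \<alpha>) * (8 * \<delta>)" using \<alpha> \<delta> by (intro mult_right_mono) auto
      finally show "8 * \<bar>\<eta>' (Suc k) - \<eta> (Suc k)\<bar> \<le> (1 + \<alpha>) * (8 * \<delta>)" .
    qed (use \<alpha> in auto)
    finally have "(1 + \<alpha>) * \<bar>d k + d (Suc k)\<bar> \<le> (1 + \<alpha>) * (8 * \<delta> + \<bar>d (Suc k) + d (Suc (Suc k))\<bar>)"
      using \<alpha> by (simp only: abs_mult abs_of_pos add_pos_pos zero_less_one
            distrib_left[of "1 + \<alpha>" "8 * \<delta>"])
    then show ?thesis using \<alpha> by (simp add: mult_le_cancel_left_pos)
  qed
  \<comment> \<open>The index i counts steps downwards from N; each step adds a fresh error
    \<open>8 * \<delta>\<close>.\<close>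
  have pair: "\<bar>d (N - i) + d (Suc (N - i))\<bar> \<le> 2 * \<tau> + 8 * \<delta> * real i" if "i \<le> N" for i
    using that
  proof (induction i)
    case 0
    then show ?case using dN by simp
  next
    case (Suc i)
    then have "Suc (N - Suc i) = N - i" by simp
    then show ?case using step[of "N - Suc i"] Suc by (simp add: algebra_simps)
  qed
  \<comment> \<open>Recovering single entries from sums of neighbours by the triangle inequality
    accumulates once more, hence the second factor N.\<close>
  have single: "\<bar>d (N - i)\<bar> \<le> \<tau> + real i * (2 * \<tau> + 8 * \<delta> * real N)" if "i \<le> N" for i
    using that
  proof (induction i)
    case 0
    then show ?case using dN by simp
  next
    case (Suc i)
    have eq: "Suc (N - Suc i) = N - i" using Suc.prems by simp
    have "8 * \<delta> * real (Suc i) \<le> 8 * \<delta> * real N"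
      using Suc.prems \<delta> by (intro mult_left_mono) auto
    then have "\<bar>d (N - Suc i) + d (N - i)\<bar> \<le> 2 * \<tau> + 8 * \<delta> * real N"
      using pair[OF Suc.prems] unfolding eq by linarith
    moreover have "\<bar>d (N - i)\<bar> \<le> \<tau> + real i * (2 * \<tau> + 8 * \<delta> * real N)"
      using Suc by simp
    moreover have "real (Suc i) * (2 * \<tau> + 8 * \<delta> * real N) =
        real i * (2 * \<tau> + 8 * \<delta> * real N) + (2 * \<tau> + 8 * \<delta> * real N)"
      by (simp add: distrib_right)
    ultimately show ?case by linarith
  qed
  have "\<bar>d k\<bar> \<le> \<tau> + real N * (2 * \<tau> + 8 * \<delta> * real N)"
  proof (cases "k = Suc N")
    case True
    have "0 \<le> real N * (2 * \<tau> + 8 * \<delta> * real N)" using \<tau> \<delta> by simp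
    then show ?thesis using True dN(2) by simp
  next
    case False
    then have k: "N - (N - k) = k" "N - k \<le> N" using assms(6) by auto
    have "real (N - k) * (2 * \<tau> + 8 * \<delta> * real N) \<le> real N * (2 * \<tau> + 8 * \<delta> * real N)"
      using \<tau> \<delta> by (intro mult_right_mono) auto
    then show ?thesis using single[OF k(2)] unfolding k(1) by linarith
  qed
  then show ?thesis by (simp add: d_def)
qed

text \<open>The unprimed sequences \<open>\<eta>\<close>, \<open>\<mu>\<close>, \<open>\<xi>\<close>
  stand for the exact coefficients of the right-hand side, of the derivative and of the solution.
  Here \<open>\<delta>\<close> is the error of the product step and \<open>\<tau>\<close> the size
  of the exact values that the algorithm replaces by zero.\<close>

lemma integrated_coeff_error:
  assumes A: "A > 0" and N: "N \<ge> 1"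
    and rec: "\<And>k. 8 * \<eta> (Suc k) = 2 * \<mu> (Suc k) + \<mu> k * (1 + A / real (Suc k)) +
                \<mu> (Suc (Suc k)) * (1 - A / real (Suc k))"
    and \<xi>0: "\<eta> 0 = (\<mu> 0 + \<mu> 1) / 4 + A * \<xi> 0"
    and \<xi>: "\<And>k. \<xi> (Suc k) = (\<mu> k - \<mu> (Suc (Suc k))) / (8 * real (Suc k))"
    and \<eta>: "\<And>k. k \<le> N \<Longrightarrow> \<bar>\<eta>' k - \<eta> k\<bar> \<le> \<delta>"
    and \<mu>: "\<bar>\<mu> N\<bar> \<le> \<tau>" "\<bar>\<mu> (Suc N)\<bar> \<le> \<tau>" and k: "k \<le> N"
  shows "\<bar>integrated_coeff A \<eta>' (downward_rec N A \<eta>') k - \<xi> k\<bar> \<le>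
           (1 + 1 / A) * 10 * (real N + 1)^2 * (\<delta> + \<tau>)"
proof -
  define M where "M = \<tau> + real N * (2 * \<tau> + 8 * \<delta> * real N)"
  define \<mu>' where "\<mu>' = downward_rec N A \<eta>'"
  have err: "\<bar>\<mu>' l - \<mu> l\<bar> \<le> M" if "l \<le> Suc N" for l
    unfolding M_def \<mu>'_def by (rule downward_rec_error[OF A rec \<eta> \<mu> that])
  have \<delta>: "0 \<le> \<delta>" using \<eta>[of 0] by simp
  have \<tau>: "0 \<le> \<tau>" using \<mu>(1) by linarith
  have err1: "\<bar>\<mu>' 1 - \<mu> 1\<bar> \<le> M" by (rule err) simp
  have M: "0 \<le> M" using \<delta> \<tau> by (simp add: M_def)
  \<comment> \<open>The summand 1/A serves index 0, where the algorithm divides by A; the summand 1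
    serves all other indices.\<close>
  have "\<bar>integrated_coeff A \<eta>' \<mu>' k - \<xi> k\<bar> \<le> (1 + 1 / A) * (\<delta> + M)"
  proof (cases k)
    case 0
    have "integrated_coeff A \<eta>' \<mu>' 0 - \<xi> 0 =
        1 / A * ((\<eta>' 0 - \<eta> 0) - 1 / 4 * ((\<mu>' 0 - \<mu> 0) + (\<mu>' 1 - \<mu> 1)))"
      using \<xi>0 A by (simp add: integrated_coeff_def field_simps)
    also have "\<bar>\<dots>\<bar> = 1 / A * \<bar>(\<eta>' 0 - \<eta> 0) - 1 / 4 * ((\<mu>' 0 - \<mu> 0) + (\<mu>' 1 - \<mu> 1))\<bar>"
      using A by (simp add: abs_mult)
    also have "\<dots> \<le> 1 / A * (\<delta> + M)"
    proof (intro mult_left_mono)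
      show "\<bar>(\<eta>' 0 - \<eta> 0) - 1 / 4 * ((\<mu>' 0 - \<mu> 0) + (\<mu>' 1 - \<mu> 1))\<bar> \<le> \<delta> + M"
      proof -
        have "\<bar>e - 1 / 4 * (x + y)\<bar> \<le> \<delta> + M" if "\<bar>e\<bar> \<le> \<delta>" "\<bar>x\<bar> \<le> M" "\<bar>y\<bar> \<le> M" for e x y
        proof -
          have "\<bar>x + y\<bar> \<le> 2 * M" using that by linarith
          then have "\<bar>1 / 4 * (x + y)\<bar> \<le> M" using M by (simp add: abs_mult)
          then show ?thesis using that(1) by linarith
        qed
        then show ?thesis using \<eta>[OF le0] err[OF le0] err1 .
      qed
    qed (use A in auto)
    also have "\<dots> \<le> (1 + 1 / A) * (\<delta> + M)"
      using \<delta> M by (intro mult_right_mono) auto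
    finally show ?thesis using 0 by simp
  next
    case (Suc l)
    have "integrated_coeff A \<eta>' \<mu>' k - \<xi> k =
        ((\<mu>' l - \<mu> l) - (\<mu>' (Suc (Suc l)) - \<mu> (Suc (Suc l)))) / (8 * real (Suc l))"
      using \<xi>[of l] Suc by (simp add: integrated_coeff_def diff_divide_distrib del: of_nat_Suc)
    also have "\<bar>\<dots>\<bar> = \<bar>(\<mu>' l - \<mu> l) - (\<mu>' (Suc (Suc l)) - \<mu> (Suc (Suc l)))\<bar> / (8 * real (Suc l))"
      by (simp add: abs_divide del: of_nat_Suc)
    also have "\<dots> \<le> (2 * M) / (8 * 1)"
      using err[of l] err[of "Suc (Suc l)"] k Suc M
      by (intro frac_le) auto
    also have "\<dots> \<le> 1 * (\<delta> + M)" using M \<delta> by simp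
    also have "\<dots> \<le> (1 + 1 / A) * (\<delta> + M)"
      using \<delta> M A by (intro mult_right_mono) auto
    finally show ?thesis .
  qed
  also have "\<dots> \<le> (1 + 1 / A) * (10 * (real N + 1)^2 * (\<delta> + \<tau>))"
  proof (intro mult_left_mono)
    \<comment> \<open>The constant 10 exceeds the 8 in M, so that the expanded difference has only
      nonnegative terms.\<close>
    have "0 \<le> \<tau> * real N" "0 \<le> \<tau> * (real N)^2" "0 \<le> \<delta> * real N" "0 \<le> \<delta> * (real N)^2"
      using \<delta> \<tau> by auto
    moreover have "10 * (real N + 1)^2 * (\<delta> + \<tau>) - (\<delta> + M) =
        9 * \<tau> + 9 * \<delta> + 18 * (\<tau> * real N) + 20 * (\<delta> * real N) + 10 * (\<tau> * (real N)^2) + 2 * (\<delta> * (real N)^2)"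
      by (simp add: M_def power2_eq_square algebra_simps)
    ultimately show "\<delta> + M \<le> 10 * (real N + 1)^2 * (\<delta> + \<tau>)"
      using \<delta> \<tau> by linarith
  qed (use A in auto)
  finally show ?thesis by (simp only: \<mu>'_def mult.assoc)
qed

section \<open>One step of the algorithm and the induction over the steps\<close>

lemma node_value_eq: "node_value N \<xi> j = cos_partial_sum N \<xi> (cheb_angle N j)"
  by (simp add: node_value_def cos_partial_sum_def)

lemma product_coeff_eq:
  "product_coeff N \<beta> v k =
     discrete_coeff N (\<lambda>j. (1 - cheb_point (cheb_angle N j)) powr (\<beta> - 1) * v j) k"
  by (simp add: product_coeff_def discrete_coeff_def cheb_node_def cheb_point_def)

lemma abs_cos_partial_sum_diff_le:
  assumes "\<And>k. k \<le> N \<Longrightarrow> \<bar>c k - c' k\<bar> \<le> E"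
  shows "\<bar>cos_partial_sum N c \<theta> - cos_partial_sum N c' \<theta>\<bar> \<le> (real N + 1) * E"
proof -
  have E: "0 \<le> E" using assms[of 0] by simp
  have "cos_partial_sum N c \<theta> - cos_partial_sum N c' \<theta> =
      (c 0 - c' 0) / 2 + (\<Sum>k=1..N. (c k - c' k) * cos (real k * \<theta>))"
    by (simp add: cos_partial_sum_def left_diff_distrib sum_subtractf diff_divide_distrib)
  also have "\<bar>\<dots>\<bar> \<le> \<bar>(c 0 - c' 0) / 2\<bar> + (\<Sum>k=1..N. \<bar>(c k - c' k) * cos (real k * \<theta>)\<bar>)"
    by (intro order_trans[OF abs_triangle_ineq] add_left_mono sum_abs)
  also have "\<dots> \<le> E + (\<Sum>k=1..N. E * 1)"
  proof (intro add_mono sum_mono)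
    show "\<bar>(c 0 - c' 0) / 2\<bar> \<le> E" using assms[of 0] E by simp
    fix k assume "k \<in> {1..N}"
    then show "\<bar>(c k - c' k) * cos (real k * \<theta>)\<bar> \<le> E * 1"
      unfolding abs_mult by (intro mult_mono assms E) auto
  qed
  finally show ?thesis by (simp add: algebra_simps)
qed

text \<open>Here |ln(1 - x)| is at most ln 2, so exponents of either sign are covered and the
  weights at the nodes are bounded independently of N.\<close>

lemma powr_le_on_half_interval:
  fixes x c :: real
  assumes "0 \<le> x" "x \<le> 1 / 2"
  shows "(1 - x) powr c \<le> 2 powr \<bar>c\<bar>"
proof -
  have "(1 - x) powr c = exp (c * ln (1 - x))" using assms by (simp add: powr_def)
  also have "c * ln (1 - x) \<le> \<bar>c\<bar> * ln 2"
  proof -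
    have "- ln 2 \<le> ln (1 - x)"
      using assms ln_le_cancel_iff[of "1/2" "1 - x"] by (simp add: ln_div)
    moreover have "ln (1 - x) \<le> 0" using assms by simp
    ultimately have "\<bar>ln (1 - x)\<bar> \<le> ln 2" by linarith
    then have "\<bar>c\<bar> * \<bar>ln (1 - x)\<bar> \<le> \<bar>c\<bar> * ln 2" by (intro mult_left_mono) auto
    then show ?thesis by (metis abs_ge_self abs_mult order_trans)
  qed
  finally show ?thesis by (simp add: powr_def)
qed

text \<open>Two comparisons: the computed samples with G at the nodes, which carries the inherited
  error and the truncation error of u through the bounded weight; then G with its own partial sum,
  whose discrete coefficients are exact, so that aliasing costs at most
  \<open>2 * \<epsilon>'\<close>.\<close>

lemma product_coeff_error:
  assumes \<xi>: "\<And>k. k \<le> N \<Longrightarrow> \<bar>\<xi>' k - cosine_coeff u k\<bar> \<le> E"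
    and u: "\<And>\<theta>. \<bar>u \<theta> - cos_partial_sum N (cosine_coeff u) \<theta>\<bar> \<le> \<epsilon>"
    and G: "\<And>\<theta>. G \<theta> = (1 - cheb_point \<theta>) powr (\<beta> - 1) * u \<theta>"
    and G_approx: "\<And>\<theta>. \<bar>G \<theta> - cos_partial_sum N (cosine_coeff G) \<theta>\<bar> \<le> \<epsilon>'"
    and k: "k \<le> N"
  shows "\<bar>product_coeff N \<beta> (node_value N \<xi>') k - cosine_coeff G k\<bar>
           \<le> 2 * (2 powr \<bar>\<beta> - 1\<bar> * ((real N + 1) * E + \<epsilon>)) + 2 * \<epsilon>'"
proof -
  define t where "t = cheb_angle N"
  define h where "h j = (1 - cheb_point (t j)) powr (\<beta> - 1)" for j
  define S where "S = cos_partial_sum N (cosine_coeff G)"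
  have "\<bar>discrete_coeff N (\<lambda>j. h j * node_value N \<xi>' j - G (t j)) k\<bar>
      \<le> 2 * (2 powr \<bar>\<beta> - 1\<bar> * ((real N + 1) * E + \<epsilon>))"
  proof (rule abs_discrete_coeff_le)
    fix j
    have "\<bar>node_value N \<xi>' j - u (t j)\<bar> \<le> (real N + 1) * E + \<epsilon>"
    proof -
      have "\<bar>cos_partial_sum N \<xi>' (t j) - cos_partial_sum N (cosine_coeff u) (t j)\<bar> \<le> (real N + 1) * E"
        by (rule abs_cos_partial_sum_diff_le) (rule \<xi>)
      then show ?thesis
        using u[of "t j"] unfolding node_value_eq t_def[symmetric] by linarith
    qed
    then have "\<bar>h j\<bar> * \<bar>node_value N \<xi>' j - u (t j)\<bar> \<le> 2 powr \<bar>\<beta> - 1\<bar> * ((real N + 1) * E + \<epsilon>)"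
      using powr_le_on_half_interval[OF cheb_point_bounds(1)[of "t j"] cheb_point_bounds(2)[of "t j"], of "\<beta> - 1"]
      by (intro mult_mono) (auto simp: h_def)
    then show "\<bar>h j * node_value N \<xi>' j - G (t j)\<bar> \<le> 2 powr \<bar>\<beta> - 1\<bar> * ((real N + 1) * E + \<epsilon>)"
      unfolding G h_def[symmetric] right_diff_distrib[symmetric] abs_mult .
  qed
  moreover have "\<bar>discrete_coeff N (\<lambda>j. G (t j) - S (t j)) k\<bar> \<le> 2 * \<epsilon>'"
    by (rule abs_discrete_coeff_le) (simp add: S_def G_approx)
  moreover have "discrete_coeff N (\<lambda>j. S (t j)) k = cosine_coeff G k"
    unfolding S_def t_def by (rule discrete_coeff_partial_sum[OF k])
  moreover have "product_coeff N \<beta> (node_value N \<xi>') k = discrete_coeff N (\<lambda>j. h j * node_value N \<xi>' j) k"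
    by (simp add: product_coeff_eq h_def t_def)
  ultimately show ?thesis
    unfolding discrete_coeff_diff by linarith
qed

definition beta_theta :: "(nat \<Rightarrow> real) \<Rightarrow> (nat \<Rightarrow> real) \<Rightarrow> nat \<Rightarrow> real \<Rightarrow> real" where
  "beta_theta a b m \<theta> = beta_real a b m (cheb_point \<theta>)"

lemma geometric_cos_series_slit:
  assumes "f holomorphic_on slit_plane" "r > 1" "ellipse_vertex r < 1"
  shows "geometric_cos_series r (\<lambda>\<theta>. Re (f (complex_of_real (cheb_point \<theta>))))"
  using assms(2,3)
  by (intro geometric_cos_series_holomorphic holomorphic_on_subset[OF assms(1) ball_subset_slit_plane])

text \<open>Both C and p may depend on m but not on N. Each step raises p by 3: evaluation at the
  nodes sums up to N + 1 coefficient errors, and the recursion contributes (N + 1)^2.\<close>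

lemma cheb_algorithm_error:
  assumes r: "r > 1" "ellipse_vertex r < 1"
    and a: "\<And>i. 1 \<le> i \<Longrightarrow> i \<le> m \<Longrightarrow> a i > 0"
  shows "\<exists>C p. \<forall>N k. 1 \<le> N \<longrightarrow> k \<le> N \<longrightarrow>
           \<bar>cheb_algorithm N a b m k - cosine_coeff (beta_theta a b m) k\<bar> \<le> C * (real N + 1) ^ p / r ^ N"
  using a
proof (induction m)
  case 0
  have "cheb_algorithm N a b 0 k = cosine_coeff (beta_theta a b 0) k" if "k \<le> N" for N k
  proof -
    \<comment> \<open>The initial values encode the constant function 1 exactly, the 2 at index 0
      being halved.\<close>
    have "beta_theta a b 0 = cos_partial_sum N (cheb_algorithm N a b 0)"
      using cheb_point_power[of 0 N] 
      by (simp add: beta_theta_def[abs_def] beta_real_def fun_eq_iff)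
    then show ?thesis
      using cosine_coeff_partial_sum[OF that] by simp
  qed
  then show ?case by (intro exI[of _ 0]) auto
next
  case (Suc m)
  define A where "A = (\<Sum>i=1..Suc m. a i)"
  define u where "u = beta_theta a b m"
  define u1 where "u1 = beta_theta a b (Suc m)"
  define w where "w \<theta> = beta_real' a b (Suc m) (cheb_point \<theta>)" for \<theta>
  define G where "G \<theta> = (1 - cheb_point \<theta>) powr (b (Suc m) - 1) * u \<theta>" for \<theta>
  define H where "H = 2 powr \<bar>b (Suc m) - 1\<bar>"
  have A: "A > 0" using Suc.prems sum_pos_upto_Suc unfolding A_def by blast
  have lt1: "cheb_point \<theta> < 1" for \<theta> using cheb_point_bounds(2)[of \<theta>] by linarith
  have hol: "beta_fun a b m holomorphic_on slit_plane"
    using Suc.prems by (intro holomorphic_beta_fun) auto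
  have hol1: "beta_fun a b (Suc m) holomorphic_on slit_plane"
    using Suc.prems by (intro holomorphic_beta_fun) auto
  have hol1': "deriv (beta_fun a b (Suc m)) holomorphic_on slit_plane"
    by (rule holomorphic_deriv[OF hol1 open_slit_plane])
  have holG: "(\<lambda>z. (1 - z) powr complex_of_real (b (Suc m) - 1) * beta_fun a b m z) holomorphic_on slit_plane"
    by (intro holomorphic_on_mult holomorphic_one_minus_powr hol)
  have "geometric_cos_series r u"
    using geometric_cos_series_slit[OF hol r] by (simp add: u_def beta_theta_def[abs_def] beta_real_def)
  then obtain Ku where Ku: "\<And>k \<theta>. \<bar>u \<theta> - cos_partial_sum k (cosine_coeff u) \<theta>\<bar> \<le> Ku / r ^ k"
    unfolding geometric_cos_series_def by blast
  have "geometric_cos_series r G"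
    using geometric_cos_series_slit[OF holG r]
    by (simp only: one_minus_powr_of_real[OF lt1] G_def[abs_def] u_def beta_theta_def[abs_def] beta_real_def) simp
  then obtain KG where KG: "\<And>k \<theta>. \<bar>G \<theta> - cos_partial_sum k (cosine_coeff G) \<theta>\<bar> \<le> KG / r ^ k"
    unfolding geometric_cos_series_def by blast
  have "geometric_cos_series r w"
    using geometric_cos_series_slit[OF hol1' r] by (simp add: w_def[abs_def] beta_real'_def)
  then obtain Kw where Kw: "\<And>k. \<bar>cosine_coeff w k\<bar> \<le> Kw / r ^ k"
    unfolding geometric_cos_series_def by blast
  have cont': "continuous_on {0..1/2} (beta_real' a b (Suc m))"
    unfolding beta_real'_def[abs_def]
    by (intro continuous_on_Re continuous_on_holomorphic_of_real hol1') auto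
  have contw: "continuous_on {0..pi} w"
    unfolding w_def by (rule continuous_on_compose2[OF cont'])
      (use cheb_point_bounds in \<open>auto intro!: continuous_intros\<close>)
  have "continuous_on {0..1/2} (beta_real a b (Suc m))"
    unfolding beta_real_def[abs_def]
    by (intro continuous_on_Re continuous_on_holomorphic_of_real hol1) auto
  then have contu1: "continuous_on {0..pi} u1"
    unfolding u1_def beta_theta_def[abs_def]
    by (rule continuous_on_compose2) (use cheb_point_bounds in \<open>auto intro!: continuous_intros\<close>)
  have by_parts: "cosine_coeff u1 (Suc k) = (cosine_coeff w k - cosine_coeff w (Suc (Suc k))) / (8 * real (Suc k))" for k
    unfolding u1_def beta_theta_def[abs_def] w_def[abs_def]
    by (intro cosine_coeff_by_parts beta_real_deriv cont' Suc.prems) auto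
  have G_eq: "G \<theta> = 1 * (cheb_point \<theta> * w \<theta>) + A * u1 \<theta>" for \<theta>
    using beta_real_ode[where m = m and a = a and b = b and x = "cheb_point \<theta>", OF Suc.prems lt1]
    by (simp add: G_def w_def u_def u1_def beta_theta_def A_def)
  have "cosine_coeff (\<lambda>\<theta>. 1 * (cheb_point \<theta> * w \<theta>) + A * u1 \<theta>) k =
      1 * cosine_coeff (\<lambda>\<theta>. cheb_point \<theta> * w \<theta>) k + A * cosine_coeff u1 k" for k
    by (intro cosine_coeff_lincomb continuous_intros contw contu1)
  then have G: "cosine_coeff G k = cosine_coeff (\<lambda>\<theta>. cheb_point \<theta> * w \<theta>) k + A * cosine_coeff u1 k" for k
    unfolding G_eq[symmetric] by simp
  have G0: "cosine_coeff G 0 = (cosine_coeff w 0 + cosine_coeff w 1) / 4 + A * cosine_coeff u1 0"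
    unfolding G cosine_coeff_cheb_point_mult(1)[OF contw] ..
  \<comment> \<open>The exact counterpart of the downward recursion: integration by parts eliminates
    the coefficients of \<open>u1\<close> in favour of those of its derivative
    \<open>w\<close>.\<close>
  have GS: "8 * cosine_coeff G (Suc k) = 2 * cosine_coeff w (Suc k) + cosine_coeff w k * (1 + A / real (Suc k)) +
                cosine_coeff w (Suc (Suc k)) * (1 - A / real (Suc k))" for k
    unfolding G cosine_coeff_cheb_point_mult(2)[OF contw] by_parts
    by (simp add: field_simps del: of_nat_Suc)
  obtain C p where IH: "\<And>N k. 1 \<le> N \<Longrightarrow> k \<le> N \<Longrightarrow>
      \<bar>cheb_algorithm N a b m k - cosine_coeff u k\<bar> \<le> C * (real N + 1) ^ p / r ^ N"
    using Suc.IH Suc.prems unfolding u_def by (metis le_SucI)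
  \<comment> \<open>Absolute values are taken because the constants obtained above come without a
    sign.\<close>
  define C' where "C' = (1 + 1 / A) * 10 * (2 * H * (\<bar>C\<bar> + \<bar>Ku\<bar>) + 2 * \<bar>KG\<bar> + \<bar>Kw\<bar>)"
  have "\<bar>cheb_algorithm N a b (Suc m) k - cosine_coeff u1 k\<bar> \<le> C' * (real N + 1) ^ (p + 3) / r ^ N"
    if N: "1 \<le> N" and k: "k \<le> N" for N k
  proof -
    define E where "E = C * (real N + 1) ^ p / r ^ N"
    define \<delta> where "\<delta> = 2 * (H * ((real N + 1) * E + Ku / r ^ N)) + 2 * (KG / r ^ N)"
    define \<tau> where "\<tau> = \<bar>Kw\<bar> / r ^ N"
    define \<eta> where "\<eta> = product_coeff N (b (Suc m)) (node_value N (cheb_algorithm N a b m))"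
    have \<eta>: "\<bar>\<eta> k - cosine_coeff G k\<bar> \<le> \<delta>" if "k \<le> N" for k
      unfolding \<eta>_def \<delta>_def H_def
      by (rule product_coeff_error[OF _ Ku G_def KG that]) (use IH N in \<open>simp add: E_def\<close>)
    have \<tau>: "\<bar>cosine_coeff w N\<bar> \<le> \<tau>" "\<bar>cosine_coeff w (Suc N)\<bar> \<le> \<tau>"
    proof -
      have "Kw / r ^ N \<le> \<tau>" unfolding \<tau>_def using r by (intro divide_right_mono) auto
      then show "\<bar>cosine_coeff w N\<bar> \<le> \<tau>" using Kw[of N] by linarith
      have "Kw / r ^ Suc N \<le> \<bar>Kw\<bar> / r ^ N" using r by (intro frac_le power_increasing) auto
      then show "\<bar>cosine_coeff w (Suc N)\<bar> \<le> \<tau>" using Kw[of "Suc N"] unfolding \<tau>_def by linarith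
    qed
    have "\<bar>cheb_algorithm N a b (Suc m) k - cosine_coeff u1 k\<bar> \<le>
        (1 + 1 / A) * 10 * (real N + 1)^2 * (\<delta> + \<tau>)"
      using integrated_coeff_error[OF A N GS G0 by_parts \<eta> \<tau> k]
      by (simp only: cheb_algorithm.simps Let_def A_def \<eta>_def)
    also have "\<dots> \<le> (1 + 1 / A) * 10 * (real N + 1)^2 *
        ((2 * H * (\<bar>C\<bar> + \<bar>Ku\<bar>) + 2 * \<bar>KG\<bar> + \<bar>Kw\<bar>) * (real N + 1) ^ (p + 1) / r ^ N)"
    proof (intro mult_left_mono)
      define P where "P = (real N + 1) ^ (p + 1)"
      have P: "P \<ge> 1" unfolding P_def by (intro one_le_power) auto
      have "\<delta> + \<tau> = (2 * H * (C * P + Ku) + 2 * KG + \<bar>Kw\<bar>) / r ^ N"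
        unfolding \<delta>_def \<tau>_def E_def P_def by (simp add: add_divide_distrib distrib_left mult_ac)
      also have "\<dots> \<le> (2 * H * (\<bar>C\<bar> + \<bar>Ku\<bar>) + 2 * \<bar>KG\<bar> + \<bar>Kw\<bar>) * P / r ^ N"
      proof (intro divide_right_mono)
        have bound: "x \<le> \<bar>x\<bar> * P" "\<bar>x\<bar> \<le> \<bar>x\<bar> * P" for x :: real
          using mult_left_mono[OF P, of "\<bar>x\<bar>"] by simp_all
        have "C * P \<le> \<bar>C\<bar> * P" using P by (intro mult_right_mono) auto
        then have "C * P + Ku \<le> (\<bar>C\<bar> + \<bar>Ku\<bar>) * P"
          using bound(1)[of Ku] by (simp add: distrib_right)
        then have "2 * H * (C * P + Ku) \<le> 2 * H * ((\<bar>C\<bar> + \<bar>Ku\<bar>) * P)"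
          by (intro mult_left_mono) (auto simp: H_def)
        moreover have "2 * KG \<le> 2 * \<bar>KG\<bar> * P" using bound(1)[of KG] by simp
        ultimately have "2 * H * (C * P + Ku) + 2 * KG + \<bar>Kw\<bar> \<le>
            2 * H * ((\<bar>C\<bar> + \<bar>Ku\<bar>) * P) + 2 * \<bar>KG\<bar> * P + \<bar>Kw\<bar> * P"
          using bound(2)[of Kw] by linarith
        then show "2 * H * (C * P + Ku) + 2 * KG + \<bar>Kw\<bar> \<le> (2 * H * (\<bar>C\<bar> + \<bar>Ku\<bar>) + 2 * \<bar>KG\<bar> + \<bar>Kw\<bar>) * P"
          by (simp only: distrib_right mult.assoc)
      qed (use r in auto)
      finally show "\<delta> + \<tau> \<le> (2 * H * (\<bar>C\<bar> + \<bar>Ku\<bar>) + 2 * \<bar>KG\<bar> + \<bar>Kw\<bar>) * (real N + 1) ^ (p + 1) / r ^ N"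
        unfolding P_def .
    qed (use A in auto)
    also have "\<dots> = C' * (real N + 1) ^ (p + 3) / r ^ N"
      by (simp add: C'_def power_add power2_eq_square power3_eq_cube)
    finally show ?thesis .
  qed
  then show ?case unfolding u1_def by blast
qed

text \<open>The endpoint \<open>\<theta>\<close> = pi corresponds to z = 0, where the value of the
  extension is not prescribed explicitly; a single point does not affect the integral.\<close>

lemma exact_coeff_eq:
  assumes "\<And>i. 1 \<le> i \<Longrightarrow> i \<le> n \<Longrightarrow> a i > 0"
  shows "exact_coeff n a b k = cosine_coeff (beta_theta a b n) k"
proof -
  have eq: "Re (beta_ext n a b (complex_of_real ((1 + cos \<theta>) / 4))) * cos (real k * \<theta>) =
      beta_theta a b n \<theta> * cos (real k * \<theta>)" if "\<theta> \<in> {0..pi} - {pi}" for \<theta>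
  proof -
    have "cos pi < cos \<theta>" using that by (intro cos_monotone_0_pi) auto
    then have "0 < cheb_point \<theta>" by (simp add: cheb_point_def)
    moreover have "cheb_point \<theta> < 1" using cheb_point_bounds(2)[of \<theta>] by linarith
    ultimately show ?thesis
      using beta_ext_eq[of n a "cheb_point \<theta>" b] assms by (simp add: beta_theta_def cheb_point_def)
  qed
  have "integral {0..pi} (\<lambda>\<theta>. Re (beta_ext n a b (complex_of_real ((1 + cos \<theta>) / 4))) * cos (real k * \<theta>))
      = integral {0..pi} (\<lambda>\<theta>. beta_theta a b n \<theta> * cos (real k * \<theta>))"
    by (rule integral_spike[of "{pi}", OF _ eq[symmetric]]) simp_all
  then show ?thesis
    by (simp add: exact_coeff_def cheb_coeff_def cosine_coeff_def)
qed

section \<open>Absorbing the polynomial factor\<close>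

lemma polynomial_times_geometric_bounded:
  fixes x :: real
  assumes "0 < x" "x < 1"
  shows "\<exists>B. \<forall>N. (real N + 1) ^ p * x ^ N \<le> B"
proof -
  have "(\<lambda>N. (real N + 1) ^ p * x ^ N) \<longlonglongrightarrow> 0"
    using assms by real_asymp
  then have "Bseq (\<lambda>N. (real N + 1) ^ p * x ^ N)"
    by (intro convergent_imp_Bseq convergentI)
  then obtain B where "\<And>N. norm ((real N + 1) ^ p * x ^ N) \<le> B"
    by (auto simp: Bseq_def)
  then show ?thesis by (auto intro!: exI[of _ B] dest: order_trans[OF abs_ge_self])
qed

theorem theorem2:
  fixes n :: nat and a b :: "nat \<Rightarrow> real"
  assumes "\<And>i. 1 \<le> i \<Longrightarrow> i \<le> n \<Longrightarrow> a i > 0"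
    and "\<And>i. 1 \<le> i \<Longrightarrow> i \<le> n \<Longrightarrow> b i > 0"
  shows "\<exists>C::real. \<forall>N::nat. N \<ge> 1 \<longrightarrow>
           (MAX k\<in>{0..N}. \<bar>cheb_algorithm N a b n k - exact_coeff n a b k\<bar>)
             < C * 3 powr (- (8 * real N / 5))"
proof -
  define r :: real where "r = 5.82"
    \<comment> \<open>any value strictly between \<open>3\<^bsup>8/5\<^esup>\<close> and \<open>3 + 2\<surd>2\<close>\<close>
  have r: "r > 1" "ellipse_vertex r < 1" by (simp_all add: r_def ellipse_vertex_def)
  define s :: real where "s = 3 powr (8 / 5)"
  have "s < r"
  \<comment> \<open>Fifth powers reduce the comparison to 3^8 = 6561 < 5.82^5, which is about
    6677.\<close>
  proof (rule power_less_imp_less_base)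
    have "s ^ 5 = 3 powr (8 / 5 * 5)"
      unfolding s_def by (subst powr_realpow[symmetric]) (simp_all add: powr_powr)
    also have "\<dots> = 3 powr (real 8)" by simp
    also have "\<dots> = 3 ^ 8" by (subst powr_realpow) simp_all
    finally show "s ^ 5 < r ^ 5" by (simp add: r_def eval_nat_numeral)
  qed (simp add: r_def)
  have s: "s > 0" by (simp add: s_def)
  have s_power: "3 powr (- (8 * real N / 5)) = 1 / s ^ N" for N
    unfolding s_def by (simp add: powr_realpow[symmetric] powr_powr powr_minus field_simps)
  obtain C p where C: "\<And>N k. 1 \<le> N \<Longrightarrow> k \<le> N \<Longrightarrow>
      \<bar>cheb_algorithm N a b n k - cosine_coeff (beta_theta a b n) k\<bar> \<le> C * (real N + 1) ^ p / r ^ N"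
    using cheb_algorithm_error[where a = a and b = b and m = n, OF r assms(1)] by blast
  obtain B where B: "\<And>N. (real N + 1) ^ p * (s / r) ^ N \<le> B"
    using polynomial_times_geometric_bounded[of "s / r" p] s \<open>s < r\<close> by auto
  show ?thesis
  \<comment> \<open>The added 1 makes the inequality strict even when C is 0.\<close>
  proof (intro exI[of _ "\<bar>C\<bar> * B + 1"] allI impI)
    fix N :: nat assume N: "N \<ge> 1"
    have "\<bar>cheb_algorithm N a b n k - exact_coeff n a b k\<bar> < (\<bar>C\<bar> * B + 1) * 3 powr (- (8 * real N / 5))"
      if "k \<le> N" for k
    proof -
      have "\<bar>cheb_algorithm N a b n k - exact_coeff n a b k\<bar> \<le> C * (real N + 1) ^ p / r ^ N"
        using C[OF N that] exact_coeff_eq[where a = a and n = n, OF assms(1)] by simp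
      also have "\<dots> \<le> \<bar>C\<bar> * (real N + 1) ^ p / r ^ N"
        using r by (intro divide_right_mono mult_right_mono) auto
      also have "\<dots> = \<bar>C\<bar> * ((real N + 1) ^ p * (s / r) ^ N) * (1 / s ^ N)"
        using s by (simp add: power_divide)
      also have "\<dots> \<le> \<bar>C\<bar> * B * (1 / s ^ N)"
        using s by (intro mult_right_mono mult_left_mono B) auto
      also have "\<dots> < (\<bar>C\<bar> * B + 1) * (1 / s ^ N)"
        using s by (intro mult_strict_right_mono) auto
      finally show ?thesis unfolding s_power .
    qed
    then show "(MAX k\<in>{0..N}. \<bar>cheb_algorithm N a b n k - exact_coeff n a b k\<bar>)
        < (\<bar>C\<bar> * B + 1) * 3 powr (- (8 * real N / 5))"
      by (subst Max_less_iff) auto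
  qed
qed

end
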